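(* The emptiness problem and the membership problem are solvable for the class Surface: there is an algorithm that, given (a description of) a tree language $U$ in Surface, decides whether $U=\emptyset$, and there is an algorithm that, given (a description of) a tree language $U$ in Surface and a tree $t$, decides whether $t\in U$.
   Context: Alphabets are finite. A ranked alphabet $\Sigma$ is a finite set of symbols with, for each $k\ge 0$, a subset $\Sigma_k$ (symbols of rank $k$; a symbol may have several ranks), $\Sigma=\bigcup_k\Sigma_k$, only finitely many $\Sigma_k$ nonempty. $T_\Sigma$ is the set of trees over $\Sigma$: $a\in T_\Sigma$ for $a\in\Sigma_0$, and $a[t_1\cdots t_k]\in T_\Sigma$ for $k\ge1$, $a\in\Sigma_k$, $t_i\in T_\Sigma$. A tree transformation from $T_\Sigma$ into $T_\Delta$ is a subset of $T_\Sigma\times T_\Delta$; maps $f:T_\Sigma\to T_\Delta$ are identified with $\{(s,t)\mid f(s)=t\}$ and maps $f:T_\Sigma\to\mathcal P(T_\Delta)$ with $\{(s,t)\mid t\in f(s)\}$. $M_1\circ M_2=\{(s,t)\mid (s,u)\in M_1,(u,t)\in M_2\text{ for some }u\}$ ($M_1$ applied first). $M(L)=\{t\mid(s,t)\in M\text{ for some }s\in L\}$. $X_k=\{x_1,\dots,x_k\}$ are variables; $T_\Delta(X_k)$ is the set of trees over $\Delta\cup X_k$, variables having rank $0$. Recognizable tree languages (class RECOG): $L=\{t\in T_\Sigma\mid\widehat\delta(t)\in F\}$ for some finite set $Q$, $F\subseteq Q$, $s_a\in Q$ ($a\in\Sigma_0$), $\delta_a^k:Q^k\to Q$ ($k\ge1,a\in\Sigma_k$),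 where $\widehat\delta(a)=s_a$, $\widehat\delta(a[t_1\cdots t_k])=\delta_a^k(\widehat\delta(t_1),\dots,\widehat\delta(t_k))$ (a deterministic bottom-up finite tree automaton). $REL$ (relabelings): families of maps $r_k:\Sigma_k\to\mathcal P(\Delta_k)$, acting by $r(a)=r_0(a)$, $r(a[t_1\cdots t_k])=\{b[s_1\cdots s_k]\mid b\in r_k(a),s_i\in r(t_i)\}$. $FTA$ (finite tree automaton restrictions): $\{(t,t)\mid t\in L\}$ with $L$ recognizable. $HOM$ (tree homomorphisms): families of maps $h_k:\Sigma_k\to T_\Delta(X_k)$, acting by $h(a)=h_0(a)$, $h(a[t_1\cdots t_k])=h_k(a)\langle x_1\gets h(t_1),\dots,x_k\gets h(t_k)\rangle$ (simultaneous substitution). $(REL\cup FTA\cup HOM)^*$ is the class of all compositions $M_1\circ\cdots\circ M_n$, $n\ge1$, with each $M_i\in REL\cup FTA\cup HOM$. Surface is the class of tree languages $M(L)$ with $M\in(REL\cup FTA\cup HOM)^*$ and $L\in\mathrm{RECOG}$. A language in Surface is given by a finite tree automaton for $L$ and the finite sequence $M_1,\dots,M_n$, each $M_i$ given by its defining finite data (the maps $r_k$, a finite tree automaton, or the maps $h_k$). *)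

theory Defs
  imports Main "HOL-Library.Nat_Bijection"
begin

section \<open>Ranked trees\<close>

datatype 'a tree = Node 'a "'a tree list"

text \<open>A ranked alphabet is a finite set of pairs: \<open>(a, k) \<in> \<Sigma>\<close> means that \<open>a\<close> is a symbol of
  rank \<open>k\<close>. One symbol may have several ranks.\<close>

type_synonym 'a ranked = "('a \<times> nat) set"

inductive_set trees :: "'a ranked \<Rightarrow> 'a tree set" for \<Sigma> :: "'a ranked" where
  "(a, length ts) \<in> \<Sigma> \<Longrightarrow> \<forall>t\<in>set ts. t \<in> trees \<Sigma> \<Longrightarrow> Node a ts \<in> trees \<Sigma>"

text \<open>Trees over \<open>\<Delta> \<union> X\<^sub>k\<close>. Variables are numbered from 0, so \<open>Var i\<close> is the variable
  \<open>x\<^bsub>i+1\<^esub>\<close>.\<close>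

datatype 'a vtree = Var nat | Sym 'a "'a vtree list"

inductive_set vtrees :: "'a ranked \<Rightarrow> nat \<Rightarrow> 'a vtree set" for \<Delta> :: "'a ranked" and k :: nat where
  "i < k \<Longrightarrow> Var i \<in> vtrees \<Delta> k"
| "(a, length ps) \<in> \<Delta> \<Longrightarrow> \<forall>p\<in>set ps. p \<in> vtrees \<Delta> k \<Longrightarrow> Sym a ps \<in> vtrees \<Delta> k"

primrec subst :: "'a tree list \<Rightarrow> 'a vtree \<Rightarrow> 'a tree" where
  "subst us (Var i) = us ! i"
| "subst us (Sym a ps) = Node a (map (subst us) ps)"


section \<open>Recognizable tree languages\<close>

text \<open>\<open>step A a [q\<^sub>1, \<dots>, q\<^sub>k]\<close> is \<open>\<delta>\<^sub>a\<^sup>k(q\<^sub>1, \<dots>, q\<^sub>k)\<close>; the case of the empty list is the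
  state \<open>s\<^sub>a\<close>.\<close>

record ('q, 'a) fta =
  alphabet :: "'a ranked"
  states :: "'q set"
  final :: "'q set"
  step :: "'a \<Rightarrow> 'q list \<Rightarrow> 'q"

definition is_fta :: "('q, 'a) fta \<Rightarrow> bool" where
  "is_fta A \<longleftrightarrow> finite (alphabet A) \<and> finite (states A) \<and> final A \<subseteq> states A \<and>
     (\<forall>a qs. (a, length qs) \<in> alphabet A \<and> set qs \<subseteq> states A \<longrightarrow> step A a qs \<in> states A)"

primrec run :: "('q, 'a) fta \<Rightarrow> 'a tree \<Rightarrow> 'q" where
  "run A (Node a ts) = step A a (map (run A) ts)"

definition fta_lang :: "('q, 'a) fta \<Rightarrow> 'a tree set" where
  "fta_lang A = {t \<in> trees (alphabet A). run A t \<in> final A}"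

text \<open>State sets are finite, so taking states from \<^typ>\<open>nat\<close> loses no generality.\<close>

definition RECOG :: "'a tree set set" where
  "RECOG = {fta_lang A | A :: (nat, 'a) fta. is_fta A}"


section \<open>Tree transformations and the class Surface\<close>

definition is_relabeling :: "'a ranked \<Rightarrow> 'b ranked \<Rightarrow> (nat \<Rightarrow> 'a \<Rightarrow> 'b set) \<Rightarrow> bool" where
  "is_relabeling \<Sigma> \<Delta> r \<longleftrightarrow> (\<forall>a k. (a, k) \<in> \<Sigma> \<longrightarrow> r k a \<subseteq> {b. (b, k) \<in> \<Delta>})"

primrec relabel :: "(nat \<Rightarrow> 'a \<Rightarrow> 'b set) \<Rightarrow> 'a tree \<Rightarrow> 'b tree set" where
  "relabel r (Node a ts) =
     {Node b ss | b ss. b \<in> r (length ts) a \<and> ss \<in> listset (map (relabel r) ts)}"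

definition rel_trans :: "'a ranked \<Rightarrow> (nat \<Rightarrow> 'a \<Rightarrow> 'b set) \<Rightarrow> ('a tree \<times> 'b tree) set" where
  "rel_trans \<Sigma> r = {(s, t). s \<in> trees \<Sigma> \<and> t \<in> relabel r s}"

definition REL :: "('a tree \<times> 'b tree) set set" where
  "REL = {rel_trans \<Sigma> r | \<Sigma> \<Delta> r. finite \<Sigma> \<and> finite \<Delta> \<and> is_relabeling \<Sigma> \<Delta> r}"

definition FTA :: "('a tree \<times> 'a tree) set set" where
  "FTA = {Id_on L | L. L \<in> RECOG}"

definition is_hom :: "'a ranked \<Rightarrow> 'b ranked \<Rightarrow> (nat \<Rightarrow> 'a \<Rightarrow> 'b vtree) \<Rightarrow> bool" where
  "is_hom \<Sigma> \<Delta> h \<longleftrightarrow> (\<forall>a k. (a, k) \<in> \<Sigma> \<longrightarrow> h k a \<in> vtrees \<Delta> k)"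

primrec hom :: "(nat \<Rightarrow> 'a \<Rightarrow> 'b vtree) \<Rightarrow> 'a tree \<Rightarrow> 'b tree" where
  "hom h (Node a ts) = subst (map (hom h) ts) (h (length ts) a)"

definition hom_trans :: "'a ranked \<Rightarrow> (nat \<Rightarrow> 'a \<Rightarrow> 'b vtree) \<Rightarrow> ('a tree \<times> 'b tree) set" where
  "hom_trans \<Sigma> h = {(s, t). s \<in> trees \<Sigma> \<and> t = hom h s}"

definition HOM :: "('a tree \<times> 'b tree) set set" where
  "HOM = {hom_trans \<Sigma> h | \<Sigma> \<Delta> h. finite \<Sigma> \<and> finite \<Delta> \<and> is_hom \<Sigma> \<Delta> h}"

text \<open>\<open>M\<^sub>1 O \<dots> O M\<^sub>n\<close>, where \<open>M\<^sub>1\<close> is applied first.\<close>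

definition compose :: "('a \<times> 'a) set list \<Rightarrow> ('a \<times> 'a) set" where
  "compose Ms = foldr (O) Ms Id"

definition star :: "('a \<times> 'a) set set \<Rightarrow> ('a \<times> 'a) set set" where
  "star C = {compose Ms | Ms. Ms \<noteq> [] \<and> set Ms \<subseteq> C}"

definition Surface :: "'a tree set set" where
  "Surface = {M `` L | M L. M \<in> star (REL \<union> FTA \<union> HOM) \<and> L \<in> RECOG}"


section \<open>Finite descriptions\<close>

text \<open>Symbols and states are natural numbers; finite sets are given by lists and maps with finite
  domain by tables, which are read with \<^const>\<open>map_of\<close>.\<close>

text \<open>Alphabet, states, final states, and the entries \<open>((a, [q\<^sub>1, \<dots>, q\<^sub>k]), \<delta>\<^sub>a\<^sup>k(q\<^sub>1, \<dots>, q\<^sub>k))\<close>.\<close>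

datatype fta_desc =
  FTA_Desc "(nat \<times> nat) list" "nat list" "nat list" "((nat \<times> nat list) \<times> nat) list"

primrec fta_of :: "fta_desc \<Rightarrow> (nat, nat) fta" where
  "fta_of (FTA_Desc \<Sigma> Q F tab) =
     \<lparr>alphabet = set \<Sigma>, states = set Q, final = set F, step = (\<lambda>a qs. the (map_of tab (a, qs)))\<rparr>"

primrec valid_fta :: "fta_desc \<Rightarrow> bool" where
  "valid_fta (FTA_Desc \<Sigma> Q F tab) \<longleftrightarrow>
     (\<forall>a qs. (a, length qs) \<in> set \<Sigma> \<and> set qs \<subseteq> set Q \<longrightarrow> (a, qs) \<in> dom (map_of tab)) \<and>
     is_fta (fta_of (FTA_Desc \<Sigma> Q F tab))"

text \<open>For relabelings and homomorphisms: input alphabet, output alphabet, table. The entry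
  \<open>((k, a), b)\<close> of the table of a relabeling means \<open>b \<in> r\<^sub>k(a)\<close>; the entry \<open>((k, a), p)\<close> of the table
  of a homomorphism means \<open>h\<^sub>k(a) = p\<close>.\<close>

datatype trans_desc =
  Rel_Desc "(nat \<times> nat) list" "(nat \<times> nat) list" "((nat \<times> nat) \<times> nat) list"
| Restr_Desc fta_desc
| Hom_Desc "(nat \<times> nat) list" "(nat \<times> nat) list" "((nat \<times> nat) \<times> nat vtree) list"

definition rel_of :: "((nat \<times> nat) \<times> nat) list \<Rightarrow> nat \<Rightarrow> nat \<Rightarrow> nat set" where
  "rel_of tab k a = {b. ((k, a), b) \<in> set tab}"

definition hom_of :: "((nat \<times> nat) \<times> nat vtree) list \<Rightarrow> nat \<Rightarrow> nat \<Rightarrow> nat vtree" where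
  "hom_of tab k a = the (map_of tab (k, a))"

primrec trans_of :: "trans_desc \<Rightarrow> (nat tree \<times> nat tree) set" where
  "trans_of (Rel_Desc \<Sigma> \<Delta> tab) = rel_trans (set \<Sigma>) (rel_of tab)"
| "trans_of (Restr_Desc d) = Id_on (fta_lang (fta_of d))"
| "trans_of (Hom_Desc \<Sigma> \<Delta> tab) = hom_trans (set \<Sigma>) (hom_of tab)"

primrec valid_trans :: "trans_desc \<Rightarrow> bool" where
  "valid_trans (Rel_Desc \<Sigma> \<Delta> tab) \<longleftrightarrow> is_relabeling (set \<Sigma>) (set \<Delta>) (rel_of tab)"
| "valid_trans (Restr_Desc d) \<longleftrightarrow> valid_fta d"
| "valid_trans (Hom_Desc \<Sigma> \<Delta> tab) \<longleftrightarrow>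
     (\<forall>a k. (a, k) \<in> set \<Sigma> \<longrightarrow> (k, a) \<in> dom (map_of tab)) \<and> is_hom (set \<Sigma>) (set \<Delta>) (hom_of tab)"

type_synonym surface_desc = "fta_desc \<times> trans_desc list"

definition valid_surface :: "surface_desc \<Rightarrow> bool" where
  "valid_surface = (\<lambda>(d, ms). valid_fta d \<and> ms \<noteq> [] \<and> (\<forall>m\<in>set ms. valid_trans m))"

definition surface_lang :: "surface_desc \<Rightarrow> nat tree set" where
  "surface_lang = (\<lambda>(d, ms). compose (map trans_of ms) `` fta_lang (fta_of d))"


section \<open>Algorithms\<close>

text \<open>Algorithms are partial recursive functions; \<open>evaluates f xs y\<close> means that the function denoted
  by \<open>f\<close> is defined with value \<open>y\<close> on the argument tuple \<open>xs\<close>. Recursion and search run over the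
  first argument.\<close>

datatype recf = Zero | Succ | Proj nat | Comp recf "recf list" | Prec recf recf | Mu recf

inductive evaluates :: "recf \<Rightarrow> nat list \<Rightarrow> nat \<Rightarrow> bool" where
  "evaluates Zero xs 0"
| "evaluates Succ [x] (Suc x)"
| "i < length xs \<Longrightarrow> evaluates (Proj i) xs (xs ! i)"
| "length ys = length gs \<Longrightarrow> \<forall>i<length gs. evaluates (gs ! i) xs (ys ! i) \<Longrightarrow> evaluates f ys z \<Longrightarrow>
     evaluates (Comp f gs) xs z"
| "evaluates f xs z \<Longrightarrow> evaluates (Prec f g) (0 # xs) z"
| "evaluates (Prec f g) (n # xs) y \<Longrightarrow> evaluates g (n # y # xs) z \<Longrightarrow>
     evaluates (Prec f g) (Suc n # xs) z"
| "evaluates f (n # xs) 0 \<Longrightarrow> \<forall>m<n. \<exists>y. evaluates f (m # xs) (Suc y) \<Longrightarrow>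
     evaluates (Mu f) xs n"

text \<open>The problem \<open>P\<close> on the instances \<open>I\<close>, which are presented as tuples of numbers by \<open>code\<close>. Nothing
  is required of the algorithm on inputs that do not code an instance.\<close>

definition solvable :: "'i set \<Rightarrow> ('i \<Rightarrow> nat list) \<Rightarrow> ('i \<Rightarrow> bool) \<Rightarrow> bool" where
  "solvable I code P \<longleftrightarrow> (\<exists>f. \<forall>x\<in>I. evaluates f (code x) (if P x then 1 else 0))"


section \<open>Numerical codes of trees and descriptions\<close>

definition code_pair :: "('a \<Rightarrow> nat) \<Rightarrow> ('b \<Rightarrow> nat) \<Rightarrow> 'a \<times> 'b \<Rightarrow> nat" where
  "code_pair f g = (\<lambda>(x, y). prod_encode (f x, g y))"

definition code_list :: "('a \<Rightarrow> nat) \<Rightarrow> 'a list \<Rightarrow> nat" where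
  "code_list f xs = list_encode (map f xs)"

primrec code_tree :: "nat tree \<Rightarrow> nat" where
  "code_tree (Node a ts) = prod_encode (a, list_encode (map code_tree ts))"

primrec code_vtree :: "nat vtree \<Rightarrow> nat" where
  "code_vtree (Var i) = sum_encode (Inl i)"
| "code_vtree (Sym a ps) = sum_encode (Inr (prod_encode (a, list_encode (map code_vtree ps))))"

abbreviation code_ranked :: "(nat \<times> nat) list \<Rightarrow> nat" where
  "code_ranked \<equiv> code_list (code_pair id id)"

primrec code_fta :: "fta_desc \<Rightarrow> nat" where
  "code_fta (FTA_Desc \<Sigma> Q F tab) =
     list_encode [code_ranked \<Sigma>, code_list id Q, code_list id F,
       code_list (code_pair (code_pair id (code_list id)) id) tab]"

primrec code_trans :: "trans_desc \<Rightarrow> nat" where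
  "code_trans (Rel_Desc \<Sigma> \<Delta> tab) =
     list_encode [0, code_ranked \<Sigma>, code_ranked \<Delta>, code_list (code_pair (code_pair id id) id) tab]"
| "code_trans (Restr_Desc d) = list_encode [1, code_fta d]"
| "code_trans (Hom_Desc \<Sigma> \<Delta> tab) =
     list_encode [2, code_ranked \<Sigma>, code_ranked \<Delta>,
       code_list (code_pair (code_pair id id) code_vtree) tab]"

definition code_surface :: "surface_desc \<Rightarrow> nat" where
  "code_surface = code_pair code_fta (code_list code_trans)"


section \<open>Adequacy of the definitions\<close>

lemma evaluates_unique: "evaluates f xs y \<Longrightarrow> evaluates f xs z \<Longrightarrow> y = z"
proof (induction arbitrary: z rule: evaluates.induct)
  case (4 ys gs xs f y)
  from "4.prems" obtain ys' where ys': "length ys' = length gs"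
    "\<forall>i<length gs. evaluates (gs ! i) xs (ys' ! i)" "evaluates f ys' z"
    by (cases rule: evaluates.cases) auto
  have "ys = ys'"
    using 4 ys' by (intro nth_equalityI) auto
  then show ?case using 4 ys' by blast
next
  case (7 f n xs)
  from "7.prems" have z: "evaluates f (z # xs) 0" "\<forall>m<z. \<exists>y. evaluates f (m # xs) (Suc y)"
    by (cases rule: evaluates.cases; auto)+
  show ?case
  proof (rule linorder_cases[of n z])
    assume "n < z"
    with z(2) 7 show ?thesis by (metis nat.distinct(1))
  next
    assume "z < n"
    with z(1) 7 show ?thesis by (metis nat.distinct(1))
  qed
next
  case (6 f g n xs y z')
  from "6.prems" show ?case
    by (cases rule: evaluates.cases) (use 6 in auto)
next
  case (5 f xs z' g)
  from "5.prems" show ?case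
    by (cases rule: evaluates.cases) (use 5 in auto)
qed (erule evaluates.cases; simp)+

lemma inj_code_list: "inj f \<Longrightarrow> inj (code_list f)"
  by (rule injI) (simp add: code_list_def list_encode_eq inj_map_eq_map)

lemma inj_code_pair: "inj f \<Longrightarrow> inj g \<Longrightarrow> inj (code_pair f g)"
  by (auto simp: inj_def code_pair_def)

lemma inj_code_tree: "inj code_tree"
proof -
  have "code_tree s = code_tree t \<Longrightarrow> s = t" for s t
  proof (induction s arbitrary: t)
    case (Node a ss)
    then show ?case
      by (cases t) (auto simp: list_encode_eq intro!: list.inj_map_strong[of ss _ code_tree code_tree])
  qed
  then show ?thesis by (auto simp: inj_def)
qed

lemma inj_code_vtree: "inj code_vtree"
proof -
  have "code_vtree s = code_vtree t \<Longrightarrow> s = t" for s t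
  proof (induction s arbitrary: t)
    case (Var i)
    then show ?case by (cases t) (auto simp: sum_encode_eq)
  next
    case (Sym a ss)
    then show ?case
      by (cases t)
        (auto simp: sum_encode_eq list_encode_eq intro!: list.inj_map_strong[of ss _ code_vtree code_vtree])
  qed
  then show ?thesis by (auto simp: inj_def)
qed

lemma inj_code_fta: "inj code_fta"
proof (rule injI)
  fix d e assume "code_fta d = code_fta e"
  then show "d = e"
    by (cases d; cases e) (simp add: list_encode_eq inj_eq inj_code_list inj_code_pair)
qed

lemma inj_code_trans: "inj code_trans"
proof (rule injI)
  fix d e assume "code_trans d = code_trans e"
  then show "d = e"
    by (cases d; cases e)
      (simp_all add: list_encode_eq inj_eq inj_code_list inj_code_pair inj_code_fta inj_code_vtree)
qed

lemma inj_code_surface: "inj code_surface"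
  unfolding code_surface_def by (intro inj_code_pair inj_code_list inj_code_fta inj_code_trans)

lemma fta_described:
  fixes A :: "(nat, nat) fta"
  assumes A: "is_fta A"
  obtains d where "valid_fta d" "fta_lang (fta_of d) = fta_lang A"
proof -
  have fin: "finite (alphabet A)" "finite (states A)" "finite (final A)"
    using A by (auto simp: is_fta_def intro: finite_subset)
  obtain S Q F where SQF: "set S = alphabet A" "set Q = states A" "set F = final A"
    using fin by (meson finite_list)
  let ?K = "{(a, qs). (a, length qs) \<in> alphabet A \<and> set qs \<subseteq> states A}"
  have "?K \<subseteq> fst ` alphabet A \<times> (\<Union>k\<in>snd ` alphabet A. {qs. set qs \<subseteq> states A \<and> length qs = k})"
    by force
  then have "finite ?K"
    by (rule finite_subset) (use fin in \<open>auto simp: finite_lists_length_eq\<close>)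
  then obtain ks where ks: "set ks = ?K" by (meson finite_list)
  define tab where "tab = map (\<lambda>x. (x, step A (fst x) (snd x))) ks"
  define d where "d = FTA_Desc S Q F tab"
  have tab: "map_of tab (a, qs) = Some (step A a qs)"
    if "(a, length qs) \<in> alphabet A" "set qs \<subseteq> states A" for a qs
    using that ks by (simp add: tab_def map_of_map_restrict)
  have valid: "valid_fta d"
    using A tab SQF by (auto simp: is_fta_def d_def)
  have step: "step (fta_of d) a qs = step A a qs"
    if "(a, length qs) \<in> alphabet A" "set qs \<subseteq> states A" for a qs
    using tab[OF that] by (simp add: d_def)
  have run: "run A t \<in> states A \<and> run (fta_of d) t = run A t" if "t \<in> trees (alphabet A)" for t
    using that
  proof (induction t rule: trees.induct)
    case (1 a ts)
    then have "map (run (fta_of d)) ts = map (run A) ts" and "set (map (run A) ts) \<subseteq> states A"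
      by auto
    with 1 step[of a "map (run A) ts"] A show ?case
      by (simp add: is_fta_def del: map_eq_conv)
  qed
  have "alphabet (fta_of d) = alphabet A" "final (fta_of d) = final A"
    using SQF by (simp_all add: d_def)
  then have "fta_lang (fta_of d) = fta_lang A"
    using run by (auto simp: fta_lang_def)
  with valid that show ?thesis by blast
qed

lemma rel_described:
  fixes r :: "nat \<Rightarrow> nat \<Rightarrow> nat set"
  assumes "finite \<Sigma>" "finite \<Delta>" and r: "is_relabeling \<Sigma> \<Delta> r"
  obtains m where "valid_trans m" "trans_of m = rel_trans \<Sigma> r"
proof -
  obtain S D where SD: "set S = \<Sigma>" "set D = \<Delta>"
    using assms by (meson finite_list)
  let ?K = "{((k, a), b). (a, k) \<in> \<Sigma> \<and> b \<in> r k a}"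
  have "?K \<subseteq> (prod.swap ` \<Sigma>) \<times> (fst ` \<Delta>)"
    using r by (force simp: is_relabeling_def)
  then have "finite ?K"
    by (rule finite_subset) (use assms in auto)
  then obtain tab where tab: "set tab = ?K" by (meson finite_list)
  have eq: "rel_of tab k a = r k a" if "(a, k) \<in> \<Sigma>" for a k
    using that by (simp add: rel_of_def tab)
  have "relabel (rel_of tab) t = relabel r t" if "t \<in> trees \<Sigma>" for t
    using that
  proof (induction t rule: trees.induct)
    case (1 a ts)
    then have "map (relabel (rel_of tab)) ts = map (relabel r) ts" by auto
    with 1 eq show ?case by (simp del: map_eq_conv)
  qed
  then have "trans_of (Rel_Desc S D tab) = rel_trans \<Sigma> r"
    by (auto simp: SD rel_trans_def)
  moreover have "valid_trans (Rel_Desc S D tab)"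
    using r by (simp add: SD is_relabeling_def eq)
  ultimately show ?thesis using that by blast
qed

lemma hom_described:
  fixes h :: "nat \<Rightarrow> nat \<Rightarrow> nat vtree"
  assumes "finite \<Sigma>" "finite \<Delta>" and h: "is_hom \<Sigma> \<Delta> h"
  obtains m where "valid_trans m" "trans_of m = hom_trans \<Sigma> h"
proof -
  obtain S D where SD: "set S = \<Sigma>" "set D = \<Delta>"
    using assms by (meson finite_list)
  define tab where "tab = map (\<lambda>x. (x, h (fst x) (snd x))) (map prod.swap S)"
  have tab: "map_of tab (k, a) = Some (h k a)" if "(a, k) \<in> \<Sigma>" for a k
    unfolding tab_def map_of_map_restrict using that SD by force
  then have eq: "hom_of tab k a = h k a" if "(a, k) \<in> \<Sigma>" for a k
    using that by (simp add: hom_of_def)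
  have "hom (hom_of tab) t = hom h t" if "t \<in> trees \<Sigma>" for t
    using that
  proof (induction t rule: trees.induct)
    case (1 a ts)
    then have "map (hom (hom_of tab)) ts = map (hom h) ts" by auto
    with 1 eq show ?case by (simp del: map_eq_conv)
  qed
  then have "trans_of (Hom_Desc S D tab) = hom_trans \<Sigma> h"
    by (auto simp: SD hom_trans_def)
  moreover have "valid_trans (Hom_Desc S D tab)"
    using h tab eq by (auto simp: SD is_hom_def)
  ultimately show ?thesis using that by blast
qed

lemma trans_described:
  fixes M :: "(nat tree \<times> nat tree) set"
  assumes "M \<in> REL \<union> FTA \<union> HOM"
  obtains m where "valid_trans m" "trans_of m = M"
proof -
  consider "M \<in> REL" | "M \<in> FTA" | "M \<in> HOM" using assms by blast
  then show ?thesis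
  proof cases
    case 1
    then obtain \<Sigma> \<Delta> r where "M = rel_trans \<Sigma> r" "finite \<Sigma>" "finite \<Delta>" "is_relabeling \<Sigma> \<Delta> r"
      unfolding REL_def by blast
    with that show ?thesis by (blast intro: rel_described[of \<Sigma> \<Delta> r])
  next
    case 2
    then obtain A :: "(nat, nat) fta" where A: "is_fta A" "M = Id_on (fta_lang A)"
      unfolding FTA_def RECOG_def by blast
    obtain d where "valid_fta d" "fta_lang (fta_of d) = fta_lang A"
      using fta_described[OF A(1)] .
    with A that[of "Restr_Desc d"] show ?thesis by simp
  next
    case 3
    then obtain \<Sigma> \<Delta> h where "M = hom_trans \<Sigma> h" "finite \<Sigma>" "finite \<Delta>" "is_hom \<Sigma> \<Delta> h"
      unfolding HOM_def by blast
    with that show ?thesis by (blast intro: hom_described[of \<Sigma> \<Delta> h])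
  qed
qed

lemma valid_fta_RECOG: "valid_fta d \<Longrightarrow> fta_lang (fta_of d) \<in> RECOG"
  unfolding RECOG_def by (cases d) auto

lemma valid_trans_of:
  assumes "valid_trans m"
  shows "trans_of m \<in> REL \<union> FTA \<union> HOM"
proof (cases m)
  case (Rel_Desc S D tab)
  with assms have "trans_of m \<in> REL" unfolding REL_def by fastforce
  then show ?thesis by blast
next
  case (Restr_Desc d)
  with assms have "trans_of m \<in> FTA" unfolding FTA_def by (auto intro: valid_fta_RECOG)
  then show ?thesis by blast
next
  case (Hom_Desc S D tab)
  with assms have "trans_of m \<in> HOM" unfolding HOM_def by fastforce
  then show ?thesis by blast
qed

lemma Surface_described: "Surface = surface_lang ` {D. valid_surface D}"
proof (intro equalityI subsetI)
  fix U :: "nat tree set" assume "U \<in> Surface"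
  then obtain Ms L where U: "U = compose Ms `` L" and L: "L \<in> RECOG" and
    Ms: "Ms \<noteq> []" "set Ms \<subseteq> REL \<union> FTA \<union> HOM"
    unfolding Surface_def star_def by blast
  obtain d where d: "valid_fta d" "fta_lang (fta_of d) = L"
    using L unfolding RECOG_def by (auto elim: fta_described)
  have "\<exists>ms. map trans_of ms = Ms \<and> (\<forall>m\<in>set ms. valid_trans m)"
    using Ms(2)
  proof (induction Ms)
    case (Cons M Ms)
    then obtain ms where "map trans_of ms = Ms" "\<forall>m\<in>set ms. valid_trans m" by auto
    moreover from Cons.prems have "M \<in> REL \<union> FTA \<union> HOM" by simp
    then obtain m where "valid_trans m" "trans_of m = M" by (rule trans_described)
    ultimately show ?case by (intro exI[of _ "m # ms"]) simp
  qed simp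
  then obtain ms where "map trans_of ms = Ms" "\<forall>m\<in>set ms. valid_trans m" by blast
  with d U Ms(1) have "U = surface_lang (d, ms)" "valid_surface (d, ms)"
    by (auto simp: surface_lang_def valid_surface_def)
  then show "U \<in> surface_lang ` {D. valid_surface D}" by blast
next
  fix U assume "U \<in> surface_lang ` {D. valid_surface D}"
  then obtain d ms where v: "valid_surface (d, ms)" and U: "U = surface_lang (d, ms)" by auto
  have "compose (map trans_of ms) \<in> star (REL \<union> FTA \<union> HOM)"
    proof -
    have "map trans_of ms \<noteq> []" "set (map trans_of ms) \<subseteq> REL \<union> FTA \<union> HOM"
      using v valid_trans_of unfolding valid_surface_def set_map by blast+
    then show ?thesis unfolding star_def by blast
  qed
  moreover have "fta_lang (fta_of d) \<in> RECOG"
    using v by (simp add: valid_surface_def valid_fta_RECOG)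
  ultimately show "U \<in> Surface"
    unfolding Surface_def U surface_lang_def by blast
qed

end

(* Membership and nonemptiness are witnessed by a chain of intermediate trees; the difficulty is
   to find finite witnesses for nonmembership and emptiness. Preimages of recognizable languages
   under relabelings, restrictions and (even nonlinear) homomorphisms are recognizable. Hence, if
   no tree of the language is accepted by an automaton A, this is witnessed by a finite chain of
   automata, one before each transformation, that starts at A and ends in an automaton without
   final states. That one automaton of the chain covers the preimage of the next is in turn
   witnessed by a finite relation between states, closed under the transitions, which a machine
   can check. Emptiness is the case where A accepts all trees, and t is a nonmember iff the
   language is rejected by some A that accepts t. So each problem and its complement are
   semidecidable, and an unbounded search for a witness of either decides it. *)
theory Submission
  imports Defs
begin

section \<open>Total recursive functions of tuples\<close>

text \<open>The chain has to run backwards: a nonlinear homomorphism copies subtrees, so the image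
  of a recognizable language under it need not be recognizable, whereas a deterministic automaton
  reading the output assigns one state to all copies. The other obstacle is the machine model, which
  knows only tuples of numbers. Types are therefore coded by bijections, so that a quantifier over
  trees or automata is one over all numbers. Recursion on trees is replaced by guessing a finite
  derivation; primitive recursion is programmed only for arithmetic and a few list and search
  operations. Preimages, singleton automata and certificates are only shown to exist: the search
  finds them, so no construction on automata has to be proved computable. Library functions such as
  \<open>the\<close> and \<open>nth\<close> have unspecified values on some arguments. Hence the
  default state 0 of tables and the guards on substitutions and homomorphisms, which agree with the
  given definitions on valid descriptions.\<close>

definition computable :: "nat \<Rightarrow> (nat list \<Rightarrow> nat) \<Rightarrow> bool" where
  "computable k f \<longleftrightarrow> (\<exists>r. \<forall>xs. length xs = k \<longrightarrow> evaluates r xs (f xs))"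

lemma computable_cong:
  assumes "computable k f" and "\<And>xs. length xs = k \<Longrightarrow> g xs = f xs"
  shows "computable k g"
  using assms unfolding computable_def by metis

lemma computable_zero: "computable k (\<lambda>_. 0)"
  unfolding computable_def by (auto intro: evaluates.intros)

lemma computable_proj: "i < k \<Longrightarrow> computable k (\<lambda>xs. xs ! i)"
  unfolding computable_def by (auto intro: evaluates.intros)

lemma computable_comp:
  assumes g: "computable (length fs) g" and fs: "\<And>f. f \<in> set fs \<Longrightarrow> computable k f"
  shows "computable k (\<lambda>xs. g (map (\<lambda>f. f xs) fs))"
proof -
  obtain r where r: "\<And>ys. length ys = length fs \<Longrightarrow> evaluates r ys (g ys)"
    using g unfolding computable_def by blast
  obtain R where R: "\<And>f xs. f \<in> set fs \<Longrightarrow> length xs = k \<Longrightarrow> evaluates (R f) xs (f xs)"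
    using fs unfolding computable_def by metis
  have "evaluates (Comp r (map R fs)) xs (g (map (\<lambda>f. f xs) fs))" if "length xs = k" for xs
    using that by (intro evaluates.intros(4)[where ys = "map (\<lambda>f. f xs) fs"]) (auto intro: R r)
  then show ?thesis unfolding computable_def by blast
qed

lemma computable_comp1:
  assumes "computable (Suc 0) (\<lambda>ys. g (ys ! 0))" "computable k f"
  shows "computable k (\<lambda>xs. g (f xs))"
  using computable_comp[of "[f]" "\<lambda>ys. g (ys ! 0)" k] assms by simp

lemma computable_Suc: "computable k f \<Longrightarrow> computable k (\<lambda>xs. Suc (f xs))"
proof (rule computable_comp1[where g = Suc])
  have "evaluates Succ xs (Suc (xs ! 0))" if "length xs = Suc 0" for xs
    using that by (cases xs) (auto intro: evaluates.intros)
  then show "computable (Suc 0) (\<lambda>ys. Suc (ys ! 0))"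
    unfolding computable_def by blast
qed

lemma computable_const: "computable k (\<lambda>_. c)"
  by (induction c) (auto intro: computable_zero computable_Suc)

text \<open>In a primitive recursion the step function gets the counter and the previous value in
  front of the parameters, so functions of the parameters have to be shifted by two places.\<close>

lemma computable_drop2:
  assumes "computable k f"
  shows "computable (Suc (Suc k)) (\<lambda>ys. f (drop 2 ys))"
proof -
  have "computable (Suc (Suc k)) (\<lambda>ys. f (map (\<lambda>p. p ys) (map (\<lambda>i ys. ys ! (i + 2)) [0..<k])))"
    by (rule computable_comp) (use assms in \<open>auto intro: computable_proj\<close>)
  moreover have "map (\<lambda>p. p ys) (map (\<lambda>i ys. ys ! (i + 2)) [0..<k]) = drop 2 ys"
    if "length ys = Suc (Suc k)" for ys :: "nat list"
    using that by (intro nth_equalityI) (auto simp: add.commute)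
  ultimately show ?thesis by (elim computable_cong) simp
qed

lemma computable_rec:
  assumes f: "computable k f" and h: "computable k h"
    and g: "computable (Suc (Suc k)) (\<lambda>ys. g (ys ! 0) (ys ! 1) (drop 2 ys))"
  shows "computable k (\<lambda>xs. rec_nat (f xs) (\<lambda>n y. g n y xs) (h xs))"
proof -
  obtain rf where rf: "\<And>xs. length xs = k \<Longrightarrow> evaluates rf xs (f xs)"
    using f unfolding computable_def by blast
  obtain rg where rg: "\<And>ys. length ys = Suc (Suc k) \<Longrightarrow> evaluates rg ys (g (ys ! 0) (ys ! 1) (drop 2 ys))"
    using g unfolding computable_def by blast
  have *: "evaluates (Prec rf rg) (n # xs) (rec_nat (f xs) (\<lambda>n y. g n y xs) n)"
    if "length xs = k" for n xs
  proof (induction n)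
    case 0
    then show ?case using rf that by (auto intro: evaluates.intros)
  next
    case (Suc n)
    then show ?case
      using rg[of "n # rec_nat (f xs) (\<lambda>n y. g n y xs) n # xs"] that
      by (auto intro: evaluates.intros)
  qed
  have "computable (Suc k) (\<lambda>ys. rec_nat (f (tl ys)) (\<lambda>n y. g n y (tl ys)) (hd ys))"
    unfolding computable_def
  proof (intro exI allI impI)
    fix ys :: "nat list" assume "length ys = Suc k"
    then show "evaluates (Prec rf rg) ys (rec_nat (f (tl ys)) (\<lambda>n y. g n y (tl ys)) (hd ys))"
      using *[of "tl ys" "hd ys"] by (cases ys) auto
  qed
  \<comment> \<open>Composition with \<open>h\<close> and all \<open>k\<close> projections puts the
    recursion argument in front of an unchanged copy of the tuple.\<close>
  then have "computable (length (h # map (\<lambda>i xs. xs ! i) [0..<k]))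
      (\<lambda>ys. rec_nat (f (tl ys)) (\<lambda>n y. g n y (tl ys)) (hd ys))"
    by simp
  then have "computable k (\<lambda>xs. (\<lambda>ys. rec_nat (f (tl ys)) (\<lambda>n y. g n y (tl ys)) (hd ys))
      (map (\<lambda>p. p xs) (h # map (\<lambda>i xs. xs ! i) [0..<k])))"
    by (rule computable_comp) (use h in \<open>auto intro: computable_proj\<close>)
  moreover have "map ((\<lambda>p. p xs) \<circ> (\<lambda>i xs. xs ! i)) [0..<k] = xs" if "length xs = k" for xs :: "nat list"
    using that by (intro nth_equalityI) auto
  ultimately show ?thesis by (elim computable_cong) simp
qed

section \<open>Arithmetic and the pairing function\<close>

lemma add_eq_rec_nat: "m + n = rec_nat m (\<lambda>_ y. Suc y) n"
  by (induction n) auto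

lemma pred_eq_rec_nat: "n - 1 = rec_nat 0 (\<lambda>n _. n) n"
  by (induction n) auto

lemma diff_eq_rec_nat: "m - n = rec_nat m (\<lambda>_ y. y - 1) (n :: nat)"
  by (induction n) auto

lemma mult_eq_rec_nat: "m * n = rec_nat 0 (\<lambda>_ y. y + m) (n :: nat)"
  by (induction n) auto

lemma triangle_eq_rec_nat: "triangle n = rec_nat 0 (\<lambda>n y. y + Suc n) n"
  by (induction n) auto

lemma computable_add: "computable k f \<Longrightarrow> computable k g \<Longrightarrow> computable k (\<lambda>xs. f xs + g xs)"
  by (subst add_eq_rec_nat, rule computable_rec) (auto intro: computable_Suc computable_proj)

lemma computable_pred: "computable k f \<Longrightarrow> computable k (\<lambda>xs. f xs - 1)"
  by (subst pred_eq_rec_nat, rule computable_rec) (auto intro: computable_zero computable_proj)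

lemma computable_diff: "computable k f \<Longrightarrow> computable k g \<Longrightarrow> computable k (\<lambda>xs. f xs - g xs)"
  by (subst diff_eq_rec_nat, rule computable_rec) (auto intro: computable_pred[unfolded One_nat_def] computable_proj)

lemma computable_mult: "computable k f \<Longrightarrow> computable k g \<Longrightarrow> computable k (\<lambda>xs. f xs * g xs)"
  by (subst mult_eq_rec_nat, rule computable_rec)
    (auto intro!: computable_zero computable_add computable_drop2 computable_proj)

lemma computable_triangle: "computable k f \<Longrightarrow> computable k (\<lambda>xs. triangle (f xs))"
  by (subst triangle_eq_rec_nat, rule computable_rec) (auto intro!: computable_zero computable_add computable_Suc computable_proj)

lemma computable_prod_encode:
  "computable k f \<Longrightarrow> computable k g \<Longrightarrow> computable k (\<lambda>xs. prod_encode (f xs, g xs))"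
  unfolding prod_encode_def by (auto intro!: computable_add computable_triangle)

text \<open>The sum of the two components of the pair coded by \<open>z\<close>.\<close>

definition diagonal :: "nat \<Rightarrow> nat" where
  "diagonal z = rec_nat 0 (\<lambda>n y. y + (1 - (triangle (Suc y) - Suc n))) z"

text \<open>By truncated subtraction the increment in \<open>diagonal\<close> is 1 when the next
  number reaches the next triangular number and 0 otherwise. So \<open>diagonal z\<close> is the
  index of the last triangular number not above \<open>z\<close>.\<close>

lemma diagonal_bounds: "triangle (diagonal z) \<le> z \<and> z < triangle (Suc (diagonal z))"
proof (induction z)
  case (Suc z)
  let ?y = "diagonal z"
  have "diagonal (Suc z) = ?y + (1 - (triangle (Suc ?y) - Suc z))"
    by (simp add: diagonal_def)
  then show ?case
    using Suc by (cases "triangle (Suc ?y) = Suc z") (auto simp: not_less_eq)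
qed (simp add: diagonal_def)

lemma triangle_mono: "m \<le> n \<Longrightarrow> triangle m \<le> triangle n"
  unfolding triangle_def by (intro div_le_mono mult_le_mono) auto

lemma diagonal_prod_encode: "diagonal (prod_encode (m, n)) = m + n"
proof -
  let ?z = "prod_encode (m, n)"
  have "triangle (m + n) \<le> ?z" "?z < triangle (Suc (m + n))"
    by (auto simp: prod_encode_def)
  with diagonal_bounds[of ?z] have "triangle (m + n) < triangle (Suc (diagonal ?z))"
    "triangle (diagonal ?z) < triangle (Suc (m + n))"
    by linarith+
  then have "\<not> Suc (diagonal ?z) \<le> m + n" "\<not> Suc (m + n) \<le> diagonal ?z"
    using triangle_mono not_less by blast+
  then show ?thesis by simp
qed

text \<open>This closed form replaces the recursive definition of \<open>prod_decode\<close> by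
  primitive recursive operations.\<close>

lemma prod_decode_eq_diagonal:
  "prod_decode z = (z - triangle (diagonal z), diagonal z - (z - triangle (diagonal z)))"
proof -
  obtain m n where "z = prod_encode (m, n)" by (metis prod.exhaust prod_decode_inverse)
  then show ?thesis by (simp add: diagonal_prod_encode) (simp add: prod_encode_def)
qed

lemma computable_diagonal: "computable k f \<Longrightarrow> computable k (\<lambda>xs. diagonal (f xs))"
  unfolding diagonal_def
  by (rule computable_rec)
    (auto intro!: computable_zero computable_const computable_add computable_diff computable_triangle
      computable_Suc computable_proj simp del: triangle_Suc)

lemma computable_fst_prod_decode: "computable k f \<Longrightarrow> computable k (\<lambda>xs. fst (prod_decode (f xs)))"
  unfolding prod_decode_eq_diagonal fst_conv
  by (intro computable_diff computable_triangle computable_diagonal)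

lemma computable_snd_prod_decode: "computable k f \<Longrightarrow> computable k (\<lambda>xs. snd (prod_decode (f xs)))"
  unfolding prod_decode_eq_diagonal snd_conv
  by (intro computable_diff computable_triangle computable_diagonal)

section \<open>Types with a bijective coding by numbers\<close>

text \<open>Bijectivity, rather than injectivity, makes \<open>dec\<close> a total inverse: every
  number is a code, so functions on codes are total without a test of their input, and a search
  through all numbers is a search through the type.\<close>

class coded =
  fixes enc :: "'a \<Rightarrow> nat"
  assumes bij_enc: "bij enc"

definition dec :: "nat \<Rightarrow> 'a :: coded" where
  "dec = inv enc"

lemma dec_enc [simp]: "dec (enc x) = (x :: 'a :: coded)"
  unfolding dec_def by (rule inv_f_f) (use bij_enc bij_is_inj in blast)

lemma enc_dec [simp]: "enc (dec n :: 'a :: coded) = n"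
  unfolding dec_def by (rule surj_f_inv_f) (use bij_enc bij_is_surj in blast)

lemma enc_eq_iff [simp]: "enc x = enc y \<longleftrightarrow> x = (y :: 'a :: coded)"
  by (metis dec_enc)

lemma dec_eqI: "n = enc x \<Longrightarrow> dec n = (x :: 'a :: coded)"
  by simp

instantiation nat :: coded
begin

definition enc_nat :: "nat \<Rightarrow> nat" where [simp]: "enc_nat n = n"

instance by standard (simp add: bij_def inj_def surj_def)

end

instantiation prod :: (coded, coded) coded
begin

definition enc_prod :: "'a \<times> 'b \<Rightarrow> nat" where
  "enc_prod = (\<lambda>(x, y). prod_encode (enc x, enc y))"

instance
proof
  have "z \<in> range (enc :: 'a \<times> 'b \<Rightarrow> nat)" for z
  proof
    show "z = enc (dec (fst (prod_decode z)) :: 'a, dec (snd (prod_decode z)) :: 'b)"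
      by (simp add: enc_prod_def)
  qed simp
  then show "bij (enc :: 'a \<times> 'b \<Rightarrow> nat)"
    by (auto simp: bij_def inj_def enc_prod_def)
qed

end

instantiation list :: (coded) coded
begin

definition enc_list :: "'a list \<Rightarrow> nat" where
  "enc_list xs = list_encode (map enc xs)"

instance
proof
  have "z \<in> range (enc :: 'a list \<Rightarrow> nat)" for z
  proof
    show "z = enc (map dec (list_decode z) :: 'a list)"
      by (simp add: enc_list_def comp_def)
  qed simp
  then show "bij (enc :: 'a list \<Rightarrow> nat)"
    by (auto simp: bij_def inj_def enc_list_def list_encode_eq inj_map_eq_map)
qed

end

lemma less_list_encode: "x \<in> set xs \<Longrightarrow> x < list_encode xs"
proof (induction xs)
  case (Cons y ys)
  then show ?case
    using le_prod_encode_1[of y "list_encode ys"] le_prod_encode_2[of "list_encode ys" y] by fastforce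
qed simp

text \<open>Every number codes a root symbol and a list of strictly smaller numbers, so surjectivity
  of the codings of trees follows by strong induction.\<close>

lemma less_prod_encode_list_encode: "x \<in> set xs \<Longrightarrow> x < prod_encode (a, list_encode xs)"
  using less_list_encode le_prod_encode_2 order.strict_trans2 by blast

instantiation tree :: (coded) coded
begin

primrec enc_tree :: "'a tree \<Rightarrow> nat" where
  "enc_tree (Node a ts) = prod_encode (enc a, list_encode (map enc_tree ts))"

instance
proof
  have "enc s = enc t \<Longrightarrow> s = t" for s t :: "'a tree"
  proof (induction s arbitrary: t)
    case (Node a ss)
    then show ?case
      by (cases t) (auto simp: list_encode_eq intro!: list.inj_map_strong[of ss _ enc enc])
  qed
  moreover have "\<exists>t :: 'a tree. n = enc t" for n
  proof (induction n rule: less_induct)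
    case (less n)
    obtain a xs where n: "n = prod_encode (a, list_encode xs)"
      by (metis prod.exhaust prod_decode_inverse list_decode_inverse)
    with less have "\<forall>x\<in>set xs. \<exists>t :: 'a tree. x = enc t"
      by (blast intro: less_prod_encode_list_encode)
    then obtain ts :: "'a tree list" where "xs = map enc ts" unfolding ex_map_conv[symmetric] by blast
    then have "n = enc (Node (dec a) ts :: 'a tree)" by (simp add: n)
    then show ?case ..
  qed
  ultimately show "bij (enc :: 'a tree \<Rightarrow> nat)"
    unfolding bij_def inj_def surj_def by blast
qed

end

instantiation vtree :: (coded) coded
begin

primrec enc_vtree :: "'a vtree \<Rightarrow> nat" where
  "enc_vtree (Var i) = sum_encode (Inl i)"
| "enc_vtree (Sym a ps) = sum_encode (Inr (prod_encode (enc a, list_encode (map enc_vtree ps))))"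

instance
proof
  have "enc s = enc t \<Longrightarrow> s = t" for s t :: "'a vtree"
  proof (induction s arbitrary: t)
    case (Var i)
    then show ?case by (cases t) (auto simp: sum_encode_eq)
  next
    case (Sym a ss)
    then show ?case
      by (cases t)
        (auto simp: sum_encode_eq list_encode_eq intro!: list.inj_map_strong[of ss _ enc enc])
  qed
  moreover have "\<exists>t :: 'a vtree. n = enc t" for n
  proof (induction n rule: less_induct)
    case (less n)
    show ?case
    proof (cases "sum_decode n")
      case (Inl i)
      then have "n = enc (Var i :: 'a vtree)" by (metis enc_vtree.simps(1) sum_decode_inverse)
      then show ?thesis ..
    next
      case (Inr m)
      then have n: "n = sum_encode (Inr m)" by (metis sum_decode_inverse)
      obtain a xs where m: "m = prod_encode (a, list_encode xs)"
        by (metis prod.exhaust prod_decode_inverse list_decode_inverse)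
      have "x < n" if "x \<in> set xs" for x
        using less_prod_encode_list_encode[OF that, of a] by (simp add: n m sum_encode_def)
      with less have "\<forall>x\<in>set xs. \<exists>t :: 'a vtree. x = enc t" by blast
      then obtain ts :: "'a vtree list" where "xs = map enc ts" unfolding ex_map_conv[symmetric] by blast
      then have "n = enc (Sym (dec a) ts :: 'a vtree)" by (simp add: n m)
      then show ?thesis ..
    qed
  qed
  ultimately show "bij (enc :: 'a vtree \<Rightarrow> nat)"
    unfolding bij_def inj_def surj_def by blast
qed

end

section \<open>Recursive functions and semidecidable predicates on coded types\<close>

text \<open>The closure rules collected here follow the syntax of a term or formula, so that a
  concrete predicate is shown semidecidable without mentioning a machine.\<close>

named_theorems rec_intros

definition recursive :: "('a :: coded \<Rightarrow> 'b :: coded) \<Rightarrow> bool" where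
  "recursive f \<longleftrightarrow> computable (Suc 0) (\<lambda>xs. enc (f (dec (xs ! 0))))"

lemma recursiveI:
  assumes "computable (Suc 0) (\<lambda>xs. F (xs ! 0))" and "\<And>x. enc (f x) = F (enc x)"
  shows "recursive f"
  using assms by (simp add: recursive_def)

lemma recursiveD: "recursive f \<Longrightarrow> computable k h \<Longrightarrow> computable k (\<lambda>xs. enc (f (dec (h xs))))"
  unfolding recursive_def by (rule computable_comp1)

lemma recursive_compose: "recursive f \<Longrightarrow> recursive g \<Longrightarrow> recursive (\<lambda>x. f (g x))"
  unfolding recursive_def[of g] by (drule (1) recursiveD) (simp add: recursive_def)

lemma recursive_id [rec_intros]: "recursive (\<lambda>x. x)"
  by (simp add: recursive_def computable_proj)

lemma recursive_const [rec_intros]: "recursive (\<lambda>_. c)"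
  by (simp add: recursive_def computable_const)

lemma recursive_Pair [rec_intros]: "recursive f \<Longrightarrow> recursive g \<Longrightarrow> recursive (\<lambda>x. (f x, g x))"
  by (simp add: recursive_def enc_prod_def computable_prod_encode)

lemma recursive_fst [rec_intros]: "recursive f \<Longrightarrow> recursive (\<lambda>x. fst (f x))"
  by (rule recursive_compose[where f = fst], rule recursiveI[where F = "\<lambda>n. fst (prod_decode n)"])
    (auto intro!: computable_fst_prod_decode computable_proj simp: enc_prod_def)

lemma recursive_snd [rec_intros]: "recursive f \<Longrightarrow> recursive (\<lambda>x. snd (f x))"
  by (rule recursive_compose[where f = snd], rule recursiveI[where F = "\<lambda>n. snd (prod_decode n)"])
    (auto intro!: computable_snd_prod_decode computable_proj simp: enc_prod_def)

lemma recursive_enc [rec_intros]: "recursive f \<Longrightarrow> recursive (\<lambda>x. enc (f x))"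
  by (simp add: recursive_def)

lemma recursive_dec [rec_intros]: "recursive f \<Longrightarrow> recursive (\<lambda>x. dec (f x))"
  by (simp add: recursive_def)

lemma recursive_Suc [rec_intros]: "recursive f \<Longrightarrow> recursive (\<lambda>x. Suc (f x))"
  by (simp add: recursive_def computable_Suc)

lemma recursive_add [rec_intros]: "recursive f \<Longrightarrow> recursive g \<Longrightarrow> recursive (\<lambda>x. f x + g x :: nat)"
  by (simp add: recursive_def computable_add)

lemma recursive_diff [rec_intros]: "recursive f \<Longrightarrow> recursive g \<Longrightarrow> recursive (\<lambda>x. f x - g x :: nat)"
  by (simp add: recursive_def computable_diff)

lemma recursive_mult [rec_intros]: "recursive f \<Longrightarrow> recursive g \<Longrightarrow> recursive (\<lambda>x. f x * g x :: nat)"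
  by (simp add: recursive_def computable_mult)

lemma recursive_Cons [rec_intros]: "recursive f \<Longrightarrow> recursive g \<Longrightarrow> recursive (\<lambda>x. f x # g x)"
  by (simp add: recursive_def enc_list_def computable_prod_encode computable_Suc)

lemma recursive_tl [rec_intros]:
  assumes "recursive f"
  shows "recursive (\<lambda>x. tl (f x))"
proof (rule recursive_compose[OF _ assms], rule recursiveI)
  \<comment> \<open>\<open>[]\<close> has code 0, which the truncated predecessor leaves alone; this
    value makes the formula right for \<open>tl [] = []\<close> as well.\<close>
  have "prod_decode 0 = (0, 0)"
    using prod_encode_inverse[of "(0, 0)"] by (simp add: prod_encode_def)
  then show "enc (tl xs) = snd (prod_decode (enc xs - 1))" for xs :: "'b list"
    by (cases xs) (simp_all add: enc_list_def)
  show "computable (Suc 0) (\<lambda>xs. snd (prod_decode (xs ! 0 - 1)))"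
    by (intro computable_snd_prod_decode computable_pred computable_proj) simp
qed

lemma enc_Node: "enc (Node a ts) = prod_encode (enc a, enc ts)"
  by (simp add: enc_list_def)

lemma enc_Var: "enc (Var i) = i + i"
  by (simp add: sum_encode_def)

lemma enc_Sym: "enc (Sym a ps) = Suc (prod_encode (enc a, enc ps) + prod_encode (enc a, enc ps))"
  by (simp add: enc_list_def sum_encode_def)

lemma recursive_Node [rec_intros]: "recursive f \<Longrightarrow> recursive g \<Longrightarrow> recursive (\<lambda>x. Node (f x) (g x))"
  unfolding recursive_def enc_Node by (rule computable_prod_encode)

lemma recursive_Var [rec_intros]: "recursive f \<Longrightarrow> recursive (\<lambda>x. Var (f x))"
  unfolding recursive_def enc_Var by (simp add: computable_add)

lemma recursive_Sym [rec_intros]: "recursive f \<Longrightarrow> recursive g \<Longrightarrow> recursive (\<lambda>x. Sym (f x) (g x))"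
  unfolding recursive_def enc_Sym by (intro computable_Suc computable_add computable_prod_encode)

lemma recursive_rec_nat:
  assumes f: "recursive f" and h: "recursive h"
    and g: "recursive (\<lambda>p. g (fst p) (fst (snd p)) (snd (snd p)))"
  shows "recursive (\<lambda>x. rec_nat (f x) (\<lambda>n y. g x n y) (h x))"
proof -
  have eq: "enc (rec_nat a (\<lambda>n y. g x n y) m) = rec_nat (enc a) (\<lambda>n y. enc (g x n (dec y))) m" for a x m
  proof (induction m)
    case (Suc m)
    show ?case by (simp flip: Suc.IH)
  qed simp
  \<comment> \<open>Primitive recursion supplies counter, value and parameter in this order; here
    they are recoded as the triple of parameter, counter and value that \<open>g\<close>
    expects.\<close>
  have "computable (Suc (Suc (Suc 0)))
      (\<lambda>ys. prod_encode (drop 2 ys ! 0, prod_encode (ys ! 0, ys ! 1)))"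
    by (intro computable_prod_encode computable_drop2 computable_proj) auto
  from recursiveD[OF g this]
  have "computable (Suc (Suc (Suc 0))) (\<lambda>ys. enc (g (dec (drop 2 ys ! 0)) (ys ! 0) (dec (ys ! 1))))"
    by (rule computable_cong)
      (simp add: dec_eqI[of _ "(dec _, _, dec _)"] enc_prod_def)
  then show ?thesis
    using f h unfolding recursive_def eq by (intro computable_rec) (simp_all add: recursive_def)
qed

lemma recursive_drop [rec_intros]:
  assumes "recursive f" "recursive g"
  shows "recursive (\<lambda>x. drop (f x) (g x))"
proof -
  have "drop (Suc n) xs = tl (drop n xs)" for n and xs :: "'b list"
    by (simp add: drop_Suc tl_drop)
  then have "drop n xs = rec_nat xs (\<lambda>_ ys. tl ys) n" for n and xs :: "'b list"
    by (induction n) simp_all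
  then show ?thesis
    by (simp only:) (intro recursive_rec_nat assms rec_intros)
qed

text \<open>Stated pointwise and without totality, because the final search is sure to stop only on
  codes of instances.\<close>

lemma Mu_evaluates:
  assumes "recursive (g :: 'a :: coded \<times> nat \<Rightarrow> nat)"
  shows "\<exists>r. \<forall>x. (\<exists>m. g (x, m) = 0) \<longrightarrow> evaluates r [enc x] (LEAST m. g (x, m) = 0)"
proof -
  have "computable (Suc (Suc 0)) (\<lambda>xs. prod_encode (xs ! 1, xs ! 0))"
    by (intro computable_prod_encode computable_proj) auto
  from recursiveD[OF assms this] obtain r
    where r: "\<And>xs. length xs = Suc (Suc 0) \<Longrightarrow> evaluates r xs (g (dec (prod_encode (xs ! 1, xs ! 0))))"
    unfolding computable_def by auto
  have r: "evaluates r [m, enc x] (g (x, m))" for m x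
    using r[of "[m, enc x]"] by (simp add: dec_eqI[of _ "(x, m)"] enc_prod_def)
  have "evaluates (Mu r) [enc x] (LEAST m. g (x, m) = 0)" if "\<exists>m. g (x, m) = 0" for x
  proof (rule evaluates.intros(7))
    show "evaluates r [LEAST m. g (x, m) = 0, enc x] 0"
      using r[of "LEAST m. g (x, m) = 0" x] LeastI_ex[OF that] by simp
    show "\<forall>m<LEAST m. g (x, m) = 0. \<exists>y. evaluates r [m, enc x] (Suc y)"
      using r by (metis not_less_Least not0_implies_Suc)
  qed
  then show ?thesis by blast
qed

lemma recursive_Least:
  assumes "recursive (g :: 'a :: coded \<times> nat \<Rightarrow> nat)" and "\<And>x. \<exists>m. g (x, m) = 0"
  shows "recursive (\<lambda>x. LEAST m. g (x, m) = 0)"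
proof -
  obtain r where r: "\<And>x. evaluates r [enc x] (LEAST m. g (x, m) = 0)"
    using Mu_evaluates[OF assms(1)] assms(2) by blast
  have "evaluates r xs (LEAST m. g (dec (xs ! 0), m) = 0)" if "length xs = Suc 0" for xs
    using that r[of "dec (xs ! 0)"] by (cases xs) auto
  then show ?thesis unfolding recursive_def computable_def by auto
qed

text \<open>The length is the least \<open>n\<close> for which \<open>drop n xs\<close> is
  \<open>[]\<close>, the only list with code 0, so a search replaces recursion over lists.\<close>

lemma recursive_length [rec_intros]:
  assumes "recursive f"
  shows "recursive (\<lambda>x. length (f x))"
proof -
  have "recursive (\<lambda>xs :: 'b list. LEAST n. enc (drop (snd (xs, n)) (fst (xs, n))) = 0)"
  proof (rule recursive_Least)
    show "\<exists>m. enc (drop (snd (x, m)) (fst (x, m))) = 0" for x :: "'b list"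
      by (rule exI[of _ "length x"]) (simp add: enc_list_def)
  qed (intro rec_intros)
  moreover have "(LEAST n. enc (drop n xs) = 0) = length xs" for xs :: "'b list"
    using enc_eq_iff[of "drop _ xs" "[]"] by (intro Least_equality) (auto simp: enc_list_def)
  ultimately show ?thesis
    using assms by (auto intro: recursive_compose[of length])
qed

section \<open>Semidecidable predicates and their closure properties\<close>

definition semidec :: "('a :: coded \<Rightarrow> bool) \<Rightarrow> bool" where
  "semidec P \<longleftrightarrow> (\<exists>g. recursive g \<and> (\<forall>x. P x \<longleftrightarrow> (\<exists>m :: nat. g (x, m) = (0 :: nat))))"

lemma semidecI: "recursive g \<Longrightarrow> (\<And>x. P x \<longleftrightarrow> (\<exists>m :: nat. g (x, m) = (0 :: nat))) \<Longrightarrow> semidec P"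
  unfolding semidec_def by blast

lemma semidecE:
  fixes P :: "'a :: coded \<Rightarrow> bool"
  assumes "semidec P"
  obtains g :: "'a \<times> nat \<Rightarrow> nat" where "recursive g" "\<And>x. P x \<longleftrightarrow> (\<exists>m :: nat. g (x, m) = 0)"
  using assms unfolding semidec_def by blast

lemma semidec_compose:
  assumes "semidec P" "recursive f"
  shows "semidec (\<lambda>x. P (f x))"
proof -
  obtain g :: "_ \<Rightarrow> nat" where g: "recursive g" "\<And>x. P x \<longleftrightarrow> (\<exists>m :: nat. g (x, m) = 0)"
    using assms(1) by (rule semidecE) blast
  show ?thesis
    by (rule semidecI[where g = "\<lambda>p. g (f (fst p), snd p)"])
      (auto intro!: rec_intros recursive_compose[OF g(1)] recursive_compose[OF assms(2)] simp: g(2))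
qed

lemma semidec_compose2:
  "semidec (\<lambda>p. P (fst p) (snd p)) \<Longrightarrow> recursive f \<Longrightarrow> recursive g \<Longrightarrow> semidec (\<lambda>x. P (f x) (g x))"
  by (drule semidec_compose, erule (1) recursive_Pair) simp

lemma semidec_compose3:
  "semidec (\<lambda>p. P (fst p) (fst (snd p)) (snd (snd p))) \<Longrightarrow> recursive f \<Longrightarrow> recursive g \<Longrightarrow> recursive h \<Longrightarrow>
    semidec (\<lambda>x. P (f x) (g x) (h x))"
  by (drule semidec_compose, erule recursive_Pair, erule (1) recursive_Pair) simp

lemma semidec_eq [rec_intros]: assumes "recursive f" "recursive g" shows "semidec (\<lambda>x. f x = g x)"
  by (rule semidecI[where g = "\<lambda>p. (enc (f (fst p)) - enc (g (fst p))) + (enc (g (fst p)) - enc (f (fst p)))"])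
    (intro rec_intros assms[THEN recursive_compose], auto dest: antisym)

lemma semidec_neq [rec_intros]:
  assumes "recursive f" "recursive g"
  shows "semidec (\<lambda>x. f x \<noteq> g x)"
proof (rule semidecI)
  show "recursive (\<lambda>p. 1 - ((enc (f (fst p)) - enc (g (fst p))) + (enc (g (fst p)) - enc (f (fst p)))))"
    by (intro rec_intros assms[THEN recursive_compose])
  have "m \<noteq> n \<longleftrightarrow> 1 - ((m - n) + (n - m)) = 0" for m n :: nat
    by arith
  from this[of "enc (f _)" "enc (g _)"]
  show "f x \<noteq> g x \<longleftrightarrow> (\<exists>m. 1 - ((enc (f (fst (x, m))) - enc (g (fst (x, m)))) +
      (enc (g (fst (x, m))) - enc (f (fst (x, m))))) = 0)" for x
    by simp
qed

lemma semidec_disj [rec_intros]: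
  assumes "semidec P" "semidec Q"
  shows "semidec (\<lambda>x. P x \<or> Q x)"
proof -
  obtain g :: "_ \<Rightarrow> nat" where g: "recursive g" "\<And>x. P x \<longleftrightarrow> (\<exists>m :: nat. g (x, m) = 0)"
    using assms(1) by (rule semidecE) blast
  obtain h :: "_ \<Rightarrow> nat" where h: "recursive h" "\<And>x. Q x \<longleftrightarrow> (\<exists>m :: nat. h (x, m) = 0)"
    using assms(2) by (rule semidecE) blast
  show ?thesis
    by (rule semidecI[where g = "\<lambda>p. g p * h p"]) (auto intro!: rec_intros g(1) h(1) simp: g(2) h(2))
qed

text \<open>A sum is 0 iff both terms are. The two searches may end at different numbers, so the
  single witness codes a pair; for a disjunction the product needs no such pair.\<close>

lemma semidec_conj [rec_intros]:
  assumes "semidec P" "semidec Q"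
  shows "semidec (\<lambda>x. P x \<and> Q x)"
proof -
  obtain g :: "_ \<Rightarrow> nat" where g: "recursive g" "\<And>x. P x \<longleftrightarrow> (\<exists>m :: nat. g (x, m) = 0)"
    using assms(1) by (rule semidecE) blast
  obtain h :: "_ \<Rightarrow> nat" where h: "recursive h" "\<And>x. Q x \<longleftrightarrow> (\<exists>m :: nat. h (x, m) = 0)"
    using assms(2) by (rule semidecE) blast
  show ?thesis
  proof (rule semidecI)
    show "recursive (\<lambda>p. g (fst p, fst (dec (snd p) :: nat \<times> nat)) + h (fst p, snd (dec (snd p) :: nat \<times> nat)))"
      by (intro rec_intros recursive_compose[OF g(1)] recursive_compose[OF h(1)])
    have "(\<exists>m :: nat. R (dec m)) \<longleftrightarrow> (\<exists>a b. R (a, b))" for R :: "nat \<times> nat \<Rightarrow> bool"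
      by (metis dec_enc surj_pair)
    from this[of "\<lambda>z. g (_, fst z) + h (_, snd z) = 0"]
    show "P x \<and> Q x \<longleftrightarrow> (\<exists>m. g (fst (x, m), fst (dec (snd (x, m)) :: nat \<times> nat)) +
        h (fst (x, m), snd (dec (snd (x, m)) :: nat \<times> nat)) = 0)" for x
      by (simp add: g(2) h(2))
  qed
qed

lemma semidec_ex [rec_intros]:
  assumes "semidec (\<lambda>p. P (fst p) (snd p))"
  shows "semidec (\<lambda>x. \<exists>y. P x y)"
proof -
  obtain g :: "_ \<Rightarrow> nat" where g: "recursive g"
    "\<And>p. P (fst p) (snd p) \<longleftrightarrow> (\<exists>m :: nat. g (p, m) = 0)"
    using assms by (rule semidecE) blast
  show ?thesis
  proof (rule semidecI)
    show "recursive (\<lambda>p. g ((fst p, fst (dec (snd p) :: 'b \<times> nat)), snd (dec (snd p) :: 'b \<times> nat)))"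
      by (intro rec_intros recursive_compose[OF g(1)])
    have "(\<exists>m :: nat. R (dec m)) \<longleftrightarrow> (\<exists>a b. R (a, b))" for R :: "'b \<times> nat \<Rightarrow> bool"
      by (metis dec_enc surj_pair)
    from this[of "\<lambda>z. g ((_, fst z), snd z) = 0"]
    show "(\<exists>y. P x y) \<longleftrightarrow> (\<exists>m. g ((fst (x, m), fst (dec (snd (x, m)) :: 'b \<times> nat)),
        snd (dec (snd (x, m)) :: 'b \<times> nat)) = 0)" for x
      using g(2)[of "(x, _)"] by simp
  qed
qed

text \<open>Finitely many witnesses have a common bound \<open>M\<close>, and it suffices to search
  for \<open>M\<close>. The product \<open>h\<close> vanishes iff some witness lies below
  \<open>M\<close>, and the sum \<open>k\<close> vanishes iff all these products do.\<close>

lemma semidec_all_less [rec_intros]: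
  fixes b :: "'a :: coded \<Rightarrow> nat"
  assumes "semidec (\<lambda>p. P (fst p) (snd p))" "recursive b"
  shows "semidec (\<lambda>x. \<forall>i<b x. P x i)"
proof -
  obtain g :: "_ \<Rightarrow> nat" where g: "recursive g"
    "\<And>p. P (fst p) (snd p) \<longleftrightarrow> (\<exists>m :: nat. g (p, m) = 0)"
    using assms(1) by (rule semidecE) blast
  define h where "h p = rec_nat 1 (\<lambda>m y. y * g (fst p, m)) (snd p)" for p
  have h0: "h (p, M) = 0 \<longleftrightarrow> (\<exists>m<M. g (p, m) = 0)" for p M
    by (induction M) (auto simp: h_def less_Suc_eq)
  have h: "recursive h"
    unfolding h_def by (intro recursive_rec_nat rec_intros recursive_compose[OF g(1)])
  define k where "k p = rec_nat 0 (\<lambda>i y. y + h ((fst p, i), snd p)) (b (fst p))" for p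
  have k: "recursive k"
    unfolding k_def by (intro recursive_rec_nat rec_intros recursive_compose[OF h] recursive_compose[OF assms(2)])
  have "rec_nat 0 (\<lambda>i y. y + h ((x, i), M)) n = 0 \<longleftrightarrow> (\<forall>i<n. h ((x, i), M) = 0)" for x M n
    by (induction n) (auto simp: less_Suc_eq)
  then have k0: "k (x, M) = 0 \<longleftrightarrow> (\<forall>i<b x. \<exists>m<M. g ((x, i), m) = 0)" for x M
    by (simp add: k_def h0)
  have collect: "\<exists>M. \<forall>i<n. \<exists>m<M. R i m" if "\<forall>i<n. \<exists>m :: nat. R i m" for n :: nat and R
    using that
  proof (induction n)
    case (Suc n)
    then obtain M m where M: "\<forall>i<n. \<exists>m<M. R i m" "R n m" by auto
    then have "\<forall>i<Suc n. \<exists>m'<max M (Suc m). R i m'"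
      by (metis less_Suc_eq less_max_iff_disj lessI)
    then show ?case ..
  qed simp
  show ?thesis
  proof (rule semidecI[OF k])
    show "(\<forall>i<b x. P x i) \<longleftrightarrow> (\<exists>m. k (x, m) = 0)" for x
      unfolding k0 using g(2)[of "(x, _)"] collect[of "b x" "\<lambda>i m. g ((x, i), m) = 0"] by auto
  qed
qed

text \<open>Search for a value together with a witness that it is the right one; totality of
  \<open>f\<close> makes the search stop. This lets a function be given by derivations instead of a
  recursion scheme.\<close>

lemma recursive_graph:
  assumes "semidec (\<lambda>p. f (fst p) = snd p)"
  shows "recursive f"
proof -
  obtain g :: "_ \<Rightarrow> nat" where g: "recursive g"
    "\<And>p. f (fst p) = snd p \<longleftrightarrow> (\<exists>m :: nat. g (p, m) = 0)"
    using assms by (rule semidecE) blast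
  define h where "h p = g ((fst p, fst (dec (snd p) :: 'b \<times> nat)), snd (dec (snd p) :: 'b \<times> nat))" for p
  have h: "recursive h"
    unfolding h_def by (intro rec_intros recursive_compose[OF g(1)])
  have ex: "\<exists>m. h (x, m) = 0" for x
  proof -
    obtain m where "g ((x, f x), m) = 0" using g(2)[of "(x, f x)"] by auto
    then have "h (x, enc (f x, m)) = 0" by (simp add: h_def)
    then show ?thesis ..
  qed
  have "f x = fst (dec (LEAST m. h (x, m) = 0) :: 'b \<times> nat)" for x
  proof -
    have "h (x, LEAST m. h (x, m) = 0) = 0" using ex by (rule LeastI_ex)
    then show ?thesis using g(2)[of "(x, _)"] by (auto simp: h_def)
  qed
  then have eq: "f = (\<lambda>x. fst (dec (LEAST m. h (x, m) = 0) :: 'b \<times> nat))" by blast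
  show ?thesis
    by (subst eq) (intro rec_intros recursive_Least h ex)
qed

section \<open>Bounded quantification over lists\<close>

lemma ex_drop_eq_Cons: "(\<exists>ys. drop i xs = y # ys) \<longleftrightarrow> i < length xs \<and> xs ! i = y"
  by (metis Cons_nth_drop_Suc drop_all leI list.distinct(1) list.inject)

text \<open>Beyond the end of a list \<open>nth\<close> is unspecified, so list access is treated as
  a guarded relation and reduced to \<open>drop\<close>, which is defined everywhere.\<close>

lemma semidec_nth [rec_intros]:
  assumes "recursive f" "recursive g" "recursive h"
  shows "semidec (\<lambda>x. f x < length (g x) \<and> g x ! f x = h x)"
  unfolding ex_drop_eq_Cons[symmetric]
  by (intro rec_intros assms[THEN recursive_compose])

lemma semidec_in_set [rec_intros]:
  assumes "recursive f" "recursive g"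
  shows "semidec (\<lambda>x. f x \<in> set (g x))"
  unfolding in_set_conv_nth
  by (intro rec_intros assms[THEN recursive_compose])

lemma semidec_Ball_set [rec_intros]:
  assumes "semidec (\<lambda>p. P (fst p) (snd p))" "recursive f"
  shows "semidec (\<lambda>x. \<forall>y\<in>set (f x). P x y)"
proof -
  have "(\<forall>y\<in>set (f x). P x y) \<longleftrightarrow>
      (\<forall>i<length (f x). \<exists>y. (i < length (f x) \<and> f x ! i = y) \<and> P x y)" for x
    by (auto simp: all_set_conv_all_nth)
  then show ?thesis
    by (simp only:) (intro rec_intros assms(2)[THEN recursive_compose] assms(1)[THEN semidec_compose2] assms(2))
qed

lemma semidec_list_all2 [rec_intros]:
  assumes "semidec (\<lambda>p. P (fst p) (fst (snd p)) (snd (snd p)))" "recursive f" "recursive g"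
  shows "semidec (\<lambda>x. list_all2 (P x) (f x) (g x))"
proof -
  have "list_all2 (P x) (f x) (g x) \<longleftrightarrow> length (f x) = length (g x) \<and>
      (\<forall>i<length (f x). \<exists>y z. (i < length (f x) \<and> f x ! i = y) \<and> (i < length (g x) \<and> g x ! i = z) \<and> P x y z)" for x
    by (auto simp: list_all2_conv_all_nth)
  then show ?thesis
    by (simp only:) (intro rec_intros assms(2-)[THEN recursive_compose] assms(1)[THEN semidec_compose3] assms(2-))
qed

lemma list_all2_eq_map: "list_all2 (\<lambda>x y. f x = y) xs ys \<longleftrightarrow> map f xs = ys"
  by (auto simp: list_all2_conv_all_nth list_eq_iff_nth_eq)

lemma recursive_map [rec_intros]:
  assumes "recursive h" "recursive f"
  shows "recursive (\<lambda>x. map h (f x))"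
proof -
  have "recursive (map h)"
    by (rule recursive_graph, unfold list_all2_eq_map[symmetric])
      (intro rec_intros recursive_compose[OF assms(1)])
  then show ?thesis using assms(2) by (rule recursive_compose)
qed

text \<open>The facts derivable by finitely many applications of the rules \<open>\<Phi> premises conclusion\<close> are
  enumerated through their derivations, written as lists with the conclusion first.\<close>

lemma semidec_induct:
  fixes P :: "'a :: coded \<Rightarrow> bool" and m :: "'a \<Rightarrow> nat"
  assumes semidec: "semidec (\<lambda>p. \<Phi> (fst p) (snd p))"
    and rule: "\<And>x. P x \<Longrightarrow> \<exists>l. (\<forall>y\<in>set l. P y \<and> m y < m x) \<and> \<Phi> l x"
    and sound: "\<And>l x. \<forall>y\<in>set l. P y \<Longrightarrow> \<Phi> l x \<Longrightarrow> P x"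
  shows "semidec P"
proof -
  \<comment> \<open>Each entry finds its premises among the later entries only, which excludes
    circular derivations and allows derivations to be appended. The rule is applied to a guessed
    list \<open>l'\<close> of such entries, since \<open>\<Phi>\<close> is not assumed monotone in
    its premises.\<close>
  define just where "just d \<longleftrightarrow>
    (\<forall>i<length d. \<exists>y l. drop i d = y # l \<and> (\<exists>l'. (\<forall>z\<in>set l'. z \<in> set l) \<and> \<Phi> l' y))" for d
  have just_Nil: "just []" by (simp add: just_def)
  have just_Cons: "just (y # l) \<longleftrightarrow> (\<exists>l'. (\<forall>z\<in>set l'. z \<in> set l) \<and> \<Phi> l' y) \<and> just l" for y l
    by (simp add: just_def All_less_Suc2)
  have just_P: "just d \<Longrightarrow> \<forall>y\<in>set d. P y" for d
    by (induction d) (auto simp: just_Cons intro: sound)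
  have just_append: "just d \<Longrightarrow> just e \<Longrightarrow> just (d @ e)" for d e
    by (induction d) (auto simp: just_Cons)
  have "\<exists>d. just (x # d)" if "P x" for x
    using that
  proof (induction "m x" arbitrary: x rule: less_induct)
    case less
    from rule[OF less.prems] obtain l where l: "\<forall>y\<in>set l. P y \<and> m y < m x" "\<Phi> l x" by blast
    have "\<exists>d. just d \<and> set l \<subseteq> set d"
      using l(1)
    proof (induction l)
      case (Cons y l)
      then obtain d where d: "just d" "set l \<subseteq> set d" by auto
      from Cons.prems less.hyps[of y] obtain e where e: "just (y # e)" by auto
      have "just ((y # e) @ d)" "set (y # l) \<subseteq> set ((y # e) @ d)"
        using d just_append[OF e d(1)] by auto
      then show ?case by blast
    qed (use just_Nil in auto)
    with l(2) show ?case by (auto simp: just_Cons)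
  qed
  then have eq: "P = (\<lambda>x. \<exists>d. just (x # d))"
    using just_P by fastforce
  show ?thesis
    unfolding eq just_def by (intro rec_intros semidec[THEN semidec_compose2])
qed

text \<open>Post's theorem, relative to the inputs: an answer is promised exactly where
  \<open>P\<close> and \<open>Q\<close> are complementary, and elsewhere the search may run
  forever.\<close>

theorem solvable_complementary:
  fixes P Q :: "'a :: coded \<Rightarrow> bool"
  assumes "semidec P" "semidec Q"
  shows "\<exists>f. \<forall>x. (P x \<longleftrightarrow> \<not> Q x) \<longrightarrow> evaluates f [enc x] (if P x then 1 else 0)"
proof -
  obtain g :: "_ \<Rightarrow> nat" where g: "recursive g" "\<And>x. P x \<longleftrightarrow> (\<exists>m :: nat. g (x, m) = 0)"
    using assms(1) by (rule semidecE) blast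
  obtain h :: "_ \<Rightarrow> nat" where h: "recursive h" "\<And>x. Q x \<longleftrightarrow> (\<exists>m :: nat. h (x, m) = 0)"
    using assms(2) by (rule semidecE) blast
  have "recursive (\<lambda>p. g p * h p)" by (intro rec_intros g(1) h(1))
  from Mu_evaluates[OF this] obtain r
    where r: "\<And>x. (\<exists>m. g (x, m) * h (x, m) = 0) \<Longrightarrow> evaluates r [enc x] (LEAST m. g (x, m) * h (x, m) = 0)"
    by blast
  have "recursive (\<lambda>p. 1 - g p)" by (intro rec_intros g(1))
  then obtain s where s: "\<And>xs. length xs = Suc 0 \<Longrightarrow> evaluates s xs (1 - g (dec (xs ! 0)))"
    unfolding recursive_def computable_def by auto
  obtain p where p: "\<And>xs. length xs = Suc (Suc 0) \<Longrightarrow> evaluates p xs (prod_encode (xs ! 0, xs ! 1))"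
    using computable_prod_encode[OF computable_proj[of 0 "Suc (Suc 0)"] computable_proj[of 1 "Suc (Suc 0)"]]
    unfolding computable_def by auto
  \<comment> \<open>\<open>r\<close> finds a number that is a witness for \<open>P\<close> or for
    \<open>Q\<close>, but not for both. From the input and this number, paired by \<open>p\<close>,
    the machine \<open>s\<close> reads off which of the two it is.\<close>
  have "evaluates (Comp s [Comp p [Proj 0, r]]) [enc x] (if P x then 1 else 0)" if x: "P x \<longleftrightarrow> \<not> Q x" for x
  proof -
    have ex: "\<exists>m. g (x, m) * h (x, m) = 0" using x g(2)[of x] h(2)[of x] by auto
    obtain m where r: "evaluates r [enc x] m" and m: "g (x, m) * h (x, m) = 0"
      using r[OF ex] LeastI_ex[OF ex] by blast
    have "evaluates (Proj 0) [enc x] (enc x)"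
      using evaluates.intros(3)[of 0 "[enc x]"] by simp
    then have "evaluates (Comp p [Proj 0, r]) [enc x] (prod_encode (enc x, m))"
      using r p[of "[enc x, m]"]
      by (intro evaluates.intros(4)[where ys = "[enc x, m]"]) (auto simp: less_Suc_eq)
    moreover have "evaluates s [prod_encode (enc x, m)] (1 - g (x, m))"
      using s[of "[enc (x, m)]"] by (simp only: list.size nth_Cons_0 dec_enc) (simp only: enc_prod_def prod.case enc_nat_def)
    ultimately have "evaluates (Comp s [Comp p [Proj 0, r]]) [enc x] (1 - g (x, m))"
      by (intro evaluates.intros(4)[where ys = "[prod_encode (enc x, m)]"]) auto
    moreover have "1 - g (x, m) = (if P x then 1 else 0)"
    proof (cases "P x")
      case True
      then have "h (x, m) \<noteq> 0" using x h(2)[of x] by auto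
      then have "g (x, m) = 0" using m by simp
      with True show ?thesis by simp
    next
      case False
      then have "g (x, m) \<noteq> 0" using g(2)[of x] by auto
      then have "1 - g (x, m) = 0" by linarith
      with False show ?thesis by simp
    qed
    ultimately show ?thesis by simp
  qed
  then show ?thesis by blast
qed

section \<open>Semidecidability of the tree operations\<close>

lemma recursive_compose2:
  "recursive (\<lambda>p. F (fst p) (snd p)) \<Longrightarrow> recursive f \<Longrightarrow> recursive g \<Longrightarrow> recursive (\<lambda>x. F (f x) (g x))"
  by (drule recursive_compose, erule (1) recursive_Pair) simp

lemma recursive_compose3:
  "recursive (\<lambda>p. F (fst p) (fst (snd p)) (snd (snd p))) \<Longrightarrow>
    recursive f \<Longrightarrow> recursive g \<Longrightarrow> recursive h \<Longrightarrow> recursive (\<lambda>x. F (f x) (g x) (h x))"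
  by (drule recursive_compose, erule recursive_Pair, erule (1) recursive_Pair) simp

lemma size_less_Node: "t \<in> set ts \<Longrightarrow> size t < size (Node a ts)"
  by (simp add: less_Suc_eq_le size_list_estimation')

lemma size_less_Sym: "p \<in> set ps \<Longrightarrow> size p < size (Sym a ps)"
  by (simp add: less_Suc_eq_le size_list_estimation')

lemma list_all2_in_set_mapD:
  assumes "list_all2 (\<lambda>x y. k x y \<in> set l) xs ys" and "\<And>x y. k x y \<in> set l \<Longrightarrow> f x = y"
  shows "ys = map f xs"
proof -
  have "list_all2 (\<lambda>x y. f x = y) xs ys"
    using assms(1) by (rule list_all2_mono) (rule assms(2))
  then show ?thesis by (simp add: list_all2_eq_map)
qed

lemma list_all2_BexI: "list_all2 R xs ys \<Longrightarrow> x \<in> set xs \<Longrightarrow> \<exists>y. R x y"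
  by (auto simp: list_all2_conv_all_nth in_set_conv_nth)

text \<open>Only the first entry with the key counts, so membership in the table is not enough: a
  derivation passes over the earlier entries and checks that their keys differ.\<close>

lemma semidec_map_of [rec_intros]:
  fixes g :: "'a :: coded \<Rightarrow> 'b :: coded" and h :: "'a \<Rightarrow> 'c :: coded"
  assumes "recursive f" "recursive g" "recursive h"
  shows "semidec (\<lambda>x. map_of (f x) (g x) = Some (h x))"
proof (rule semidec_compose3[OF _ assms])
  show "semidec (\<lambda>p :: ('b \<times> 'c) list \<times> 'b \<times> 'c. map_of (fst p) (fst (snd p)) = Some (snd (snd p)))"
    (is "semidec ?P")
  proof (rule semidec_induct[where m = "\<lambda>p. length (fst p)" and
        \<Phi> = "\<lambda>l p. \<exists>e tab. fst p = e # tab \<and> (fst e = fst (snd p) \<and> snd e = snd (snd p) \<or>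
          fst e \<noteq> fst (snd p) \<and> (tab, snd p) \<in> set l)"])
    fix p :: "('b \<times> 'c) list \<times> 'b \<times> 'c"
    assume P: "?P p"
    obtain tab k v where p: "p = (tab, k, v)" by (metis surj_pair)
    from P p obtain e tab' where tab: "tab = e # tab'" by (cases tab) auto
    with P p show "\<exists>l. (\<forall>y\<in>set l. ?P y \<and> length (fst y) < length (fst p)) \<and>
        (\<exists>e tab. fst p = e # tab \<and> (fst e = fst (snd p) \<and> snd e = snd (snd p) \<or>
          fst e \<noteq> fst (snd p) \<and> (tab, snd p) \<in> set l))"
      by (intro exI[of _ "if fst e = k then [] else [(tab', k, v)]"]) (auto split: if_splits)
  qed (intro rec_intros, fastforce)
qed

section \<open>Table lookup and runs of tables\<close>

lemma map_of_eq_None_iff_Ball: "map_of tab k = None \<longleftrightarrow> (\<forall>e\<in>set tab. fst e \<noteq> k)"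
  by (auto simp: map_of_eq_None_iff)

text \<open>A deterministic automaton on \<^emph>\<open>all\<close> trees over \<^typ>\<open>nat\<close>, given by a finite table. The state 0
  is the value of every missing entry.\<close>

type_synonym table = "((nat \<times> nat list) \<times> nat) list"

definition tstep :: "table \<Rightarrow> nat \<Rightarrow> nat list \<Rightarrow> nat" where
  "tstep T a qs = (case map_of T (a, qs) of None \<Rightarrow> 0 | Some q \<Rightarrow> q)"

primrec trun :: "table \<Rightarrow> nat tree \<Rightarrow> nat" where
  "trun T (Node a ts) = tstep T a (map (trun T) ts)"

text \<open>The run on a tree with variables, given the states at the variables. The value 0 for
  variables out of range leaves nothing unspecified, so \<open>teval\<close> can be recursive on all
  arguments.\<close>

primrec teval :: "table \<Rightarrow> nat list \<Rightarrow> nat vtree \<Rightarrow> nat" where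
  "teval T qs (Var i) = (if i < length qs then qs ! i else 0)"
| "teval T qs (Sym a ps) = tstep T a (map (teval T qs) ps)"

lemma recursive_tstep [rec_intros]:
  assumes "recursive f" "recursive g" "recursive h"
  shows "recursive (\<lambda>x. tstep (f x) (g x) (h x))"
proof (rule recursive_compose3[OF recursive_graph assms])
  have "tstep T a qs = q \<longleftrightarrow> map_of T (a, qs) = Some q \<or> (\<forall>e\<in>set T. fst e \<noteq> (a, qs)) \<and> q = 0"
    for T a qs q
    by (auto simp: tstep_def map_of_eq_None_iff_Ball[symmetric] split: option.splits)
  then show "semidec (\<lambda>p. tstep (fst (fst p)) (fst (snd (fst p))) (snd (snd (fst p))) = snd p)"
    by (simp only:) (intro rec_intros)
qed

text \<open>Structural recursion becomes derivation: a step infers the state of a tree from guessed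
  states of its children, and the size of the tree is the measure.\<close>

lemma recursive_trun [rec_intros]:
  assumes "recursive f" "recursive g"
  shows "recursive (\<lambda>x. trun (f x) (g x))"
proof (rule recursive_compose2[OF recursive_graph assms])
  show "semidec (\<lambda>p. trun (fst (fst p)) (snd (fst p)) = snd p)" (is "semidec ?P")
  proof (rule semidec_induct[where m = "\<lambda>p. size (snd (fst p))" and
        \<Phi> = "\<lambda>l p. \<exists>a ts qs. snd (fst p) = Node a ts \<and>
          list_all2 (\<lambda>t q. ((fst (fst p), t), q) \<in> set l) ts qs \<and> tstep (fst (fst p)) a qs = snd p"])
    fix p assume P: "?P p"
    obtain T a ts q where p: "p = ((T, Node a ts), q)" by (metis surj_pair tree.exhaust)
    with P show "\<exists>l. (\<forall>y\<in>set l. ?P y \<and> size (snd (fst y)) < size (snd (fst p))) \<and>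
        (\<exists>a ts qs. snd (fst p) = Node a ts \<and>
          list_all2 (\<lambda>t q. ((fst (fst p), t), q) \<in> set l) ts qs \<and> tstep (fst (fst p)) a qs = snd p)"
      by (intro exI[of _ "map (\<lambda>t. ((T, t), trun T t)) ts"])
        (auto simp del: tree.size intro!: size_less_Node exI[of _ "map (trun T) ts"]
          simp: list_all2_conv_all_nth)
  next
    fix l p
    assume "\<forall>y\<in>set l. ?P y" and "\<exists>a ts qs. snd (fst p) = Node a ts \<and>
          list_all2 (\<lambda>t q. ((fst (fst p), t), q) \<in> set l) ts qs \<and> tstep (fst (fst p)) a qs = snd p"
    then show "?P p"
      using list_all2_in_set_mapD[of "\<lambda>t q. ((fst (fst p), t), q)" l _ _ "trun (fst (fst p))"]
      by fastforce
  qed (intro rec_intros)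
qed

lemma recursive_teval [rec_intros]:
  assumes "recursive f" "recursive g" "recursive h"
  shows "recursive (\<lambda>x. teval (f x) (g x) (h x))"
proof (rule recursive_compose3[OF recursive_graph assms])
  show "semidec (\<lambda>p. teval (fst (fst p)) (fst (snd (fst p))) (snd (snd (fst p))) = snd p)" (is "semidec ?P")
  proof (rule semidec_induct[where m = "\<lambda>p. size (snd (snd (fst p)))" and
        \<Phi> = "\<lambda>l p. (\<exists>i. snd (snd (fst p)) = Var i \<and>
            (i < length (fst (snd (fst p))) \<and> fst (snd (fst p)) ! i = snd p \<or>
              drop i (fst (snd (fst p))) = [] \<and> snd p = 0)) \<or>
          (\<exists>a ps qs. snd (snd (fst p)) = Sym a ps \<and>
            list_all2 (\<lambda>t q. ((fst (fst p), fst (snd (fst p)), t), q) \<in> set l) ps qs \<and>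
            tstep (fst (fst p)) a qs = snd p)"])
    fix p assume P: "?P p"
    obtain T us t q where p: "p = ((T, us, t), q)" by (metis surj_pair)
    show "\<exists>l. (\<forall>y\<in>set l. ?P y \<and> size (snd (snd (fst y))) < size (snd (snd (fst p)))) \<and>
        ((\<exists>i. snd (snd (fst p)) = Var i \<and>
            (i < length (fst (snd (fst p))) \<and> fst (snd (fst p)) ! i = snd p \<or>
              drop i (fst (snd (fst p))) = [] \<and> snd p = 0)) \<or>
          (\<exists>a ps qs. snd (snd (fst p)) = Sym a ps \<and>
            list_all2 (\<lambda>t q. ((fst (fst p), fst (snd (fst p)), t), q) \<in> set l) ps qs \<and>
            tstep (fst (fst p)) a qs = snd p))"
    proof (cases t)
      case (Var i)
      with P p show ?thesis by (intro exI[of _ "[]"]) (auto split: if_splits)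
    next
      case (Sym a ps)
      with P p show ?thesis
        by (intro exI[of _ "map (\<lambda>t. ((T, us, t), teval T us t)) ps"])
          (auto simp del: vtree.size intro!: size_less_Sym exI[of _ "map (teval T us) ps"]
            simp: list_all2_conv_all_nth)
    qed
  next
    fix l p
    assume l: "\<forall>y\<in>set l. ?P y" and "(\<exists>i. snd (snd (fst p)) = Var i \<and>
            (i < length (fst (snd (fst p))) \<and> fst (snd (fst p)) ! i = snd p \<or>
              drop i (fst (snd (fst p))) = [] \<and> snd p = 0)) \<or>
          (\<exists>a ps qs. snd (snd (fst p)) = Sym a ps \<and>
            list_all2 (\<lambda>t q. ((fst (fst p), fst (snd (fst p)), t), q) \<in> set l) ps qs \<and>
            tstep (fst (fst p)) a qs = snd p)"
    from this(2) show "?P p"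
    proof (elim disjE exE conjE)
      fix a ps qs
      assume t: "snd (snd (fst p)) = Sym a ps" "tstep (fst (fst p)) a qs = snd p"
        "list_all2 (\<lambda>t q. ((fst (fst p), fst (snd (fst p)), t), q) \<in> set l) ps qs"
      have "qs = map (teval (fst (fst p)) (fst (snd (fst p)))) ps"
        by (rule list_all2_in_set_mapD[OF t(3)]) (use l in fastforce)
      with t show "?P p" by simp
    qed auto
  qed (intro rec_intros)
qed

section \<open>Trees, relabelings, substitutions and homomorphisms\<close>

lemma semidec_trees [rec_intros]:
  fixes g :: "'a :: coded \<Rightarrow> 'b :: coded tree"
  assumes "recursive f" "recursive g"
  shows "semidec (\<lambda>x. g x \<in> trees (set (f x)))"
proof (rule semidec_compose2[OF _ assms])
  show "semidec (\<lambda>p :: ('b \<times> nat) list \<times> 'b tree. snd p \<in> trees (set (fst p)))"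
  proof (rule semidec_induct[where m = "\<lambda>p. size (snd p)" and
        \<Phi> = "\<lambda>l p. \<exists>a ts. snd p = Node a ts \<and> (a, length ts) \<in> set (fst p) \<and>
          (\<forall>t\<in>set ts. (fst p, t) \<in> set l)"])
    fix p :: "('b \<times> nat) list \<times> 'b tree"
    assume "snd p \<in> trees (set (fst p))"
    then obtain \<Sigma> a ts where "p = (\<Sigma>, Node a ts)" "(a, length ts) \<in> set \<Sigma>" "\<forall>t\<in>set ts. t \<in> trees (set \<Sigma>)"
      by (cases p) (auto elim: trees.cases)
    then show "\<exists>l. (\<forall>y\<in>set l. snd y \<in> trees (set (fst y)) \<and> size (snd y) < size (snd p)) \<and>
        (\<exists>a ts. snd p = Node a ts \<and> (a, length ts) \<in> set (fst p) \<and> (\<forall>t\<in>set ts. (fst p, t) \<in> set l))"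
      by (intro exI[of _ "map (Pair \<Sigma>) ts"]) (auto simp del: tree.size intro!: size_less_Node)
  next
    fix l and p :: "('b \<times> nat) list \<times> 'b tree"
    assume "\<forall>y\<in>set l. snd y \<in> trees (set (fst y))" and
      "\<exists>a ts. snd p = Node a ts \<and> (a, length ts) \<in> set (fst p) \<and> (\<forall>t\<in>set ts. (fst p, t) \<in> set l)"
    then show "snd p \<in> trees (set (fst p))"
      by (fastforce intro: trees.intros)
  qed (intro rec_intros)
qed

lemma listset_iff_list_all2: "xs \<in> listset As \<longleftrightarrow> list_all2 (\<in>) xs As"
  by (induction As arbitrary: xs) (auto simp: set_Cons_def list_all2_Cons2)

lemma in_relabel_Node_iff:
  "t \<in> relabel r (Node a ss) \<longleftrightarrow>
    (\<exists>b ts. t = Node b ts \<and> b \<in> r (length ss) a \<and> list_all2 (\<lambda>s t. t \<in> relabel r s) ss ts)"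
  by (auto simp: listset_iff_list_all2 list_all2_map2 list_all2_conv_all_nth)

lemma semidec_relabel [rec_intros]:
  assumes "recursive f" "recursive g" "recursive h"
  shows "semidec (\<lambda>x. h x \<in> relabel (rel_of (f x)) (g x))"
proof (rule semidec_compose3[OF _ assms])
  show "semidec (\<lambda>p. snd (snd p) \<in> relabel (rel_of (fst p)) (fst (snd p)))" (is "semidec ?P")
  proof (rule semidec_induct[where m = "\<lambda>p. size (fst (snd p))" and
        \<Phi> = "\<lambda>l p. \<exists>a ss b ts. fst (snd p) = Node a ss \<and> snd (snd p) = Node b ts \<and>
          ((length ss, a), b) \<in> set (fst p) \<and> list_all2 (\<lambda>s t. (fst p, s, t) \<in> set l) ss ts"])
    fix p assume P: "?P p"
    obtain r a ss t where p: "p = (r, Node a ss, t)" by (metis surj_pair tree.exhaust)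
    with P obtain b ts where t: "t = Node b ts" "((length ss, a), b) \<in> set r"
      "list_all2 (\<lambda>s t. t \<in> relabel (rel_of r) s) ss ts"
      unfolding in_relabel_Node_iff p fst_conv snd_conv by (auto simp: rel_of_def)
    have "\<forall>y\<in>set (zip ss ts). snd y \<in> relabel (rel_of r) (fst y)"
      using t(3) by (auto simp: list_all2_iff)
    then show "\<exists>l. (\<forall>y\<in>set l. ?P y \<and> size (fst (snd y)) < size (fst (snd p))) \<and>
        (\<exists>a ss b ts. fst (snd p) = Node a ss \<and> snd (snd p) = Node b ts \<and>
          ((length ss, a), b) \<in> set (fst p) \<and> list_all2 (\<lambda>s t. (fst p, s, t) \<in> set l) ss ts)"
      using p t by (intro exI[of _ "map (Pair r) (zip ss ts)"])
        (auto simp del: tree.size intro!: size_less_Node dest: set_zip_leftD simp: list_all2_iff)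
  next
    fix l p
    assume l: "\<forall>y\<in>set l. ?P y" and
      "\<exists>a ss b ts. fst (snd p) = Node a ss \<and> snd (snd p) = Node b ts \<and>
          ((length ss, a), b) \<in> set (fst p) \<and> list_all2 (\<lambda>s t. (fst p, s, t) \<in> set l) ss ts"
    then obtain a ss b ts where *: "fst (snd p) = Node a ss" "snd (snd p) = Node b ts"
      "((length ss, a), b) \<in> set (fst p)" "list_all2 (\<lambda>s t. (fst p, s, t) \<in> set l) ss ts" by blast
    from *(4) have "list_all2 (\<lambda>s t. t \<in> relabel (rel_of (fst p)) s) ss ts"
      by (rule list_all2_mono) (use l in fastforce)
    with * show "?P p"
      unfolding *(1) in_relabel_Node_iff by (auto simp: rel_of_def)
  qed (intro rec_intros)
qed

lemma vtrees_Var_iff [simp]: "Var i \<in> vtrees \<Delta> k \<longleftrightarrow> i < k"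
  by (auto elim: vtrees.cases intro: vtrees.intros)

lemma vtrees_Sym_iff [simp]:
  "Sym a ps \<in> vtrees \<Delta> k \<longleftrightarrow> (a, length ps) \<in> \<Delta> \<and> (\<forall>p\<in>set ps. p \<in> vtrees \<Delta> k)"
  by (auto elim: vtrees.cases intro: vtrees.intros)

lemma vtrees_mono: "p \<in> vtrees \<Delta> k \<Longrightarrow> \<Delta> \<subseteq> \<Delta>' \<Longrightarrow> p \<in> vtrees \<Delta>' k"
  by (induction rule: vtrees.induct) auto

text \<open>All copies of a substituted tree have the same state because the run is deterministic.
  This is why inverse homomorphisms preserve recognizability even when they are nonlinear.\<close>

lemma trun_subst: "p \<in> vtrees \<Delta> (length us) \<Longrightarrow> trun T (subst us p) = teval T (map (trun T) us) p"
  by (induction rule: vtrees.induct) (auto intro!: arg_cong[where f = "tstep _ _"])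

text \<open>The guard keeps the variables in range, where \<open>us ! i\<close> is specified. The
  alphabet is \<open>UNIV\<close> because only the variables are at stake.\<close>

lemma semidec_subst [rec_intros]:
  fixes h :: "'a :: coded \<Rightarrow> 'b :: coded tree"
  assumes "recursive f" "recursive g" "recursive h"
  shows "semidec (\<lambda>x. g x \<in> vtrees UNIV (length (f x)) \<and> subst (f x) (g x) = h x)"
proof (rule semidec_compose3[OF _ assms])
  show "semidec (\<lambda>p :: 'b tree list \<times> 'b vtree \<times> 'b tree.
      fst (snd p) \<in> vtrees UNIV (length (fst p)) \<and> subst (fst p) (fst (snd p)) = snd (snd p))"
    (is "semidec ?P")
  proof (rule semidec_induct[where m = "\<lambda>p. size (fst (snd p))" and
        \<Phi> = "\<lambda>l p. (\<exists>i. fst (snd p) = Var i \<and> i < length (fst p) \<and> fst p ! i = snd (snd p)) \<or>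
          (\<exists>a ps ts. fst (snd p) = Sym a ps \<and> snd (snd p) = Node a ts \<and>
            list_all2 (\<lambda>p' t. (fst p, p', t) \<in> set l) ps ts)"])
    fix p :: "'b tree list \<times> 'b vtree \<times> 'b tree"
    assume P: "?P p"
    obtain us q t where p: "p = (us, q, t)" by (metis surj_pair)
    show "\<exists>l. (\<forall>y\<in>set l. ?P y \<and> size (fst (snd y)) < size (fst (snd p))) \<and>
        ((\<exists>i. fst (snd p) = Var i \<and> i < length (fst p) \<and> fst p ! i = snd (snd p)) \<or>
          (\<exists>a ps ts. fst (snd p) = Sym a ps \<and> snd (snd p) = Node a ts \<and>
            list_all2 (\<lambda>p' t. (fst p, p', t) \<in> set l) ps ts))"
    proof (cases q)
      case (Var i)
      with P p show ?thesis by (intro exI[of _ "[]"]) auto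
    next
      case (Sym a ps)
      with P p show ?thesis
        by (intro exI[of _ "map (\<lambda>q. (us, q, subst us q)) ps"])
          (auto simp del: vtree.size intro!: size_less_Sym simp: list_all2_conv_all_nth)
    qed
  next
    fix l and p :: "'b tree list \<times> 'b vtree \<times> 'b tree"
    assume l: "\<forall>y\<in>set l. ?P y" and
      "(\<exists>i. fst (snd p) = Var i \<and> i < length (fst p) \<and> fst p ! i = snd (snd p)) \<or>
          (\<exists>a ps ts. fst (snd p) = Sym a ps \<and> snd (snd p) = Node a ts \<and>
            list_all2 (\<lambda>p' t. (fst p, p', t) \<in> set l) ps ts)"
    from this(2) show "?P p"
    proof (elim disjE exE conjE)
      fix a ps ts
      assume *: "fst (snd p) = Sym a ps" "snd (snd p) = Node a ts"
        "list_all2 (\<lambda>p' t. (fst p, p', t) \<in> set l) ps ts"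
      have "ts = map (subst (fst p)) ps"
        by (rule list_all2_in_set_mapD[OF *(3)]) (use l in fastforce)
      moreover have "\<forall>q\<in>set ps. q \<in> vtrees UNIV (length (fst p))"
        using list_all2_BexI[OF *(3)] l by fastforce
      ultimately show "?P p" using * by simp
    qed auto
  qed (intro rec_intros)
qed

text \<open>Only on these trees does \<^const>\<open>hom\<close> avoid the unspecified values of \<^const>\<open>the\<close> and
  \<^const>\<open>nth\<close>, about which no algorithm could know anything.\<close>

definition hom_dom :: "((nat \<times> nat) \<times> nat vtree) list \<Rightarrow> (nat \<times> nat) set" where
  "hom_dom tab = {(a, k). \<exists>p. map_of tab (k, a) = Some p \<and> p \<in> vtrees UNIV k}"

lemma trees_Node_iff [simp]:
  "Node a ts \<in> trees \<Sigma> \<longleftrightarrow> (a, length ts) \<in> \<Sigma> \<and> (\<forall>t\<in>set ts. t \<in> trees \<Sigma>)"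
  by (auto elim: trees.cases intro: trees.intros)

lemma trees_mono: "t \<in> trees \<Sigma> \<Longrightarrow> \<Sigma> \<subseteq> \<Sigma>' \<Longrightarrow> t \<in> trees \<Sigma>'"
  by (induction rule: trees.induct) auto

lemma semidec_hom [rec_intros]:
  assumes "recursive f" "recursive g" "recursive h"
  shows "semidec (\<lambda>x. g x \<in> trees (hom_dom (f x)) \<and> hom (hom_of (f x)) (g x) = h x)"
proof (rule semidec_compose3[OF _ assms])
  show "semidec (\<lambda>p. fst (snd p) \<in> trees (hom_dom (fst p)) \<and> hom (hom_of (fst p)) (fst (snd p)) = snd (snd p))"
    (is "semidec ?P")
  proof (rule semidec_induct[where m = "\<lambda>p. size (fst (snd p))" and
        \<Phi> = "\<lambda>l p. \<exists>a ss us q. fst (snd p) = Node a ss \<and>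
            list_all2 (\<lambda>s u. (fst p, s, u) \<in> set l) ss us \<and>
            map_of (fst p) (length us, a) = Some q \<and>
            q \<in> vtrees UNIV (length us) \<and> subst us q = snd (snd p)"])
    fix p assume P: "?P p"
    obtain tab a ss t where p: "p = (tab, Node a ss, t)" by (metis surj_pair tree.exhaust)
    with P obtain q where q: "map_of tab (length ss, a) = Some q" "q \<in> vtrees UNIV (length ss)"
      by (auto simp: hom_dom_def)
    from P p q show "\<exists>l. (\<forall>y\<in>set l. ?P y \<and> size (fst (snd y)) < size (fst (snd p))) \<and>
        (\<exists>a ss us q. fst (snd p) = Node a ss \<and>
            list_all2 (\<lambda>s u. (fst p, s, u) \<in> set l) ss us \<and>
            map_of (fst p) (length us, a) = Some q \<and>
            q \<in> vtrees UNIV (length us) \<and> subst us q = snd (snd p))"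
      by (intro exI[of _ "map (\<lambda>s. (tab, s, hom (hom_of tab) s)) ss"])
        (auto simp del: tree.size intro!: size_less_Node exI[of _ "map (hom (hom_of tab)) ss"] exI[of _ q]
          simp: list_all2_conv_all_nth hom_of_def)
  next
    fix l p
    assume l: "\<forall>y\<in>set l. ?P y" and "\<exists>a ss us q. fst (snd p) = Node a ss \<and>
            list_all2 (\<lambda>s u. (fst p, s, u) \<in> set l) ss us \<and>
            map_of (fst p) (length us, a) = Some q \<and>
            q \<in> vtrees UNIV (length us) \<and> subst us q = snd (snd p)"
    then obtain a ss us q where *: "fst (snd p) = Node a ss" "list_all2 (\<lambda>s u. (fst p, s, u) \<in> set l) ss us"
      "map_of (fst p) (length us, a) = Some q" "q \<in> vtrees UNIV (length us)" "subst us q = snd (snd p)"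
      by blast
    have "us = map (hom (hom_of (fst p))) ss"
      by (rule list_all2_in_set_mapD[OF *(2)]) (use l in fastforce)
    moreover have "\<forall>s\<in>set ss. s \<in> trees (hom_dom (fst p))"
      using list_all2_BexI[OF *(2)] l by fastforce
    ultimately show "?P p"
      using * by (auto simp: hom_dom_def hom_of_def)
  qed (intro rec_intros)
qed

section \<open>Finite tree automata given by tables\<close>

text \<open>Neither alphabet nor state set is recorded: a finite table takes finitely many values,
  and trees outside an alphabet can be sent to a state that is not final.\<close>

type_synonym automaton = "table \<times> nat list"

definition acc :: "automaton \<Rightarrow> nat tree \<Rightarrow> bool" where
  "acc A t \<longleftrightarrow> trun (fst A) t \<in> set (snd A)"

lemma finite_range_trun: "finite (range (trun T))"
proof (rule finite_subset)
  show "range (trun T) \<subseteq> insert 0 (snd ` set T)"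
  proof
    fix q assume "q \<in> range (trun T)"
    then obtain t where "q = trun T t" by blast
    then show "q \<in> insert 0 (snd ` set T)"
      by (cases t) (auto simp: tstep_def split: option.splits dest!: map_of_SomeD intro: rev_image_eqI)
  qed
qed simp

text \<open>Recognition by a finite algebra: \<open>f\<close> is a homomorphism on the trees over
  \<open>\<Sigma>\<close> with finite image in an arbitrary type. Numbering the image turns the
  algebra into a table, which spares explicit state encodings in the applications.\<close>

lemma finite_algebra_automaton:
  fixes f :: "nat tree \<Rightarrow> 's"
  assumes \<Sigma>: "finite \<Sigma>" and fin: "finite (f ` trees \<Sigma>)"
    and comp: "\<And>a ts. Node a ts \<in> trees \<Sigma> \<Longrightarrow> f (Node a ts) = g a (map f ts)"
  shows "\<exists>A. \<forall>s. acc A s \<longleftrightarrow> s \<in> trees \<Sigma> \<and> P (f s)"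
proof -
  obtain c :: "'s \<Rightarrow> nat" where c: "inj_on c (f ` trees \<Sigma>)"
    using finite_imp_inj_to_nat_seg[OF fin] by blast
  \<comment> \<open>\<open>Suc\<close> keeps the default value 0 free as the state of all trees
    outside \<open>trees \<Sigma>\<close>.\<close>
  define st where "st s = Suc (c (f s))" for s
  define d where "d q = inv_into (f ` trees \<Sigma>) c (q - 1)" for q
  have d_st: "d (st s) = f s" if "s \<in> trees \<Sigma>" for s
    using that c by (simp add: d_def st_def)
  \<comment> \<open>Only argument tuples that occur in a tree over \<open>\<Sigma>\<close> get an
    entry. They are finitely many, and \<open>comp\<close> determines the value on each.\<close>
  let ?K = "{(a, map st ts) | a ts. Node a ts \<in> trees \<Sigma>}"
  have "st ` trees \<Sigma> \<subseteq> (\<lambda>x. Suc (c x)) ` (f ` trees \<Sigma>)"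
    by (auto simp: st_def)
  with fin have fin_st: "finite (st ` trees \<Sigma>)" by (meson finite_imageI finite_subset)
  have "?K \<subseteq> fst ` \<Sigma> \<times> (\<Union>k\<in>snd ` \<Sigma>. {qs. set qs \<subseteq> st ` trees \<Sigma> \<and> length qs = k})"
    by force
  then have "finite ?K"
    by (rule finite_subset) (use \<Sigma> fin_st in \<open>auto simp: finite_lists_length_eq\<close>)
  then obtain ks where ks: "set ks = ?K" by (meson finite_list)
  define T where "T = map (\<lambda>x. (x, Suc (c (g (fst x) (map d (snd x)))))) ks"
  have T: "tstep T a qs = (if (a, qs) \<in> ?K then Suc (c (g a (map d qs))) else 0)" for a qs
    unfolding tstep_def T_def map_of_map_restrict ks restrict_map_def by (simp del: trees_Node_iff)
  have run: "trun T s = (if s \<in> trees \<Sigma> then st s else 0)" for s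
  proof (induction s)
    case (Node a ts)
    show ?case
    proof (cases "Node a ts \<in> trees \<Sigma>")
      case True
      then have "map (trun T) ts = map st ts" using Node by auto
      moreover have "map d (map st ts) = map f ts" using True d_st by auto
      moreover have "(a, map st ts) \<in> ?K" using True by blast
      ultimately show ?thesis
        using True comp[OF True] by (simp only: trun.simps T if_True st_def)
    next
      case False
      \<comment> \<open>The arguments of an entry are positive, so an entry would put all children
        into \<open>trees \<Sigma>\<close>; the rank of \<open>a\<close> would then put the node
        there too.\<close>
      have "(a, map (trun T) ts) \<notin> ?K"
      proof
        assume "(a, map (trun T) ts) \<in> ?K"
        then obtain us where us: "map (trun T) ts = map st us" "Node a us \<in> trees \<Sigma>" by blast
        have len: "length ts = length us" using us(1) map_eq_imp_length_eq by blast
        have "t \<in> trees \<Sigma>" if "t \<in> set ts" for t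
        proof (rule ccontr)
          assume "t \<notin> trees \<Sigma>"
          then have "trun T t = 0" using Node[OF that] by simp
          then have "0 \<in> set (map (trun T) ts)" using that by force
          then show False unfolding us(1) by (auto simp: st_def)
        qed
        with us(2) len False show False by simp
      qed
      with False show ?thesis by (simp only: trun.simps T if_False)
    qed
  qed
  have "finite (st ` {s \<in> trees \<Sigma>. P (f s)})"
    by (rule finite_subset[OF _ fin_st]) blast
  then obtain F where F: "set F = st ` {s \<in> trees \<Sigma>. P (f s)}" by (meson finite_list)
  have "acc (T, F) s \<longleftrightarrow> s \<in> trees \<Sigma> \<and> P (f s)" for s
  proof (cases "s \<in> trees \<Sigma>")
    case True
    have "f s' = f s" if "s' \<in> trees \<Sigma>" "st s = st s'" for s'
      using d_st[OF that(1)] d_st[OF True] that(2) by simp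
    then have "P (f s)" if "st s \<in> st ` {s \<in> trees \<Sigma>. P (f s)}"
      using that by (elim imageE CollectE conjE) (simp only:)
    with True have "st s \<in> st ` {s \<in> trees \<Sigma>. P (f s)} \<longleftrightarrow> P (f s)"
      by blast
    with True show ?thesis by (simp add: acc_def run F)
  next
    case False
    then show ?thesis by (auto simp: acc_def run F st_def)
  qed
  then show ?thesis by blast
qed

lemma finite_subtree_closure:
  "\<exists>S. finite S \<and> t \<in> S \<and> (\<forall>a ts. Node a ts \<in> S \<longrightarrow> set ts \<subseteq> S)"
proof (induction t)
  case (Node a ts)
  then obtain S where S: "\<And>t. t \<in> set ts \<Longrightarrow>
      finite (S t) \<and> t \<in> S t \<and> (\<forall>a us. Node a us \<in> S t \<longrightarrow> set us \<subseteq> S t)"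
    by metis
  show ?case
    by (rule exI[of _ "insert (Node a ts) (\<Union>t\<in>set ts. S t)"]) (use S in \<open>simp, blast\<close>)
qed

text \<open>The algebra consists of a finite set \<open>S\<close> of trees that contains
  \<open>t\<close> and is closed under subtrees, together with a sink \<open>None\<close>: a tree
  with a child outside \<open>S\<close> is itself outside \<open>S\<close>.\<close>

lemma singleton_automaton: "\<exists>A. \<forall>s. acc A s \<longleftrightarrow> s = t"
proof -
  obtain S where S: "finite S" "t \<in> S" "\<And>a ts. Node a ts \<in> S \<Longrightarrow> set ts \<subseteq> S"
    using finite_subtree_closure by metis
  define \<Sigma> where "\<Sigma> = (\<lambda>s. case s of Node a ts \<Rightarrow> (a, length ts)) ` S"
  have sub: "s \<in> S \<Longrightarrow> s \<in> trees \<Sigma>" for s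
  proof (induction s)
    case (Node a ts)
    then show ?case
      using S(3)[OF Node.prems] by (auto simp: \<Sigma>_def intro: rev_image_eqI)
  qed
  define f where "f s = (if s \<in> S then Some s else None)" for s
  define g where "g a xs = (if None \<notin> set xs then f (Node a (map the xs)) else None)" for a xs
  have comp: "f (Node a ts) = g a (map f ts)" for a ts
  proof (cases "set ts \<subseteq> S")
    case True
    then have "map (the \<circ> f) ts = ts" "None \<notin> set (map f ts)"
      by (auto simp: f_def subset_iff intro: map_idI)
    then show ?thesis by (simp add: g_def)
  next
    case False
    then have "None \<in> set (map f ts)" "Node a ts \<notin> S"
      using S(3) by (auto simp: f_def image_iff)
    then show ?thesis by (simp add: g_def f_def)
  qed
  have "f ` trees \<Sigma> \<subseteq> insert None (Some ` S)" by (auto simp: f_def)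
  then have "finite (f ` trees \<Sigma>)" using S(1) by (meson finite.insertI finite_imageI finite_subset)
  moreover have "finite \<Sigma>" using S(1) by (simp add: \<Sigma>_def)
  ultimately have "\<exists>A. \<forall>s. acc A s \<longleftrightarrow> s \<in> trees \<Sigma> \<and> f s = Some t"
    using comp by (intro finite_algebra_automaton[where P = "\<lambda>x. x = Some t"])
  moreover have "s \<in> trees \<Sigma> \<and> f s = Some t \<longleftrightarrow> s = t" for s
    using S(2) sub by (auto simp: f_def)
  ultimately show ?thesis by simp
qed

section \<open>Preimages under the basic transformations\<close>

text \<open>Each basic transformation, followed by a run of the table \<open>T\<close> on the output, is described
  by a nondeterministic bottom-up evaluation of the input tree: \<open>succs m T a zs\<close> are the values at a
  node with symbol \<open>a\<close> whose children have the values \<open>zs\<close>. The first component of a value is the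
  state of the restricting automaton; it is 0 for relabelings and homomorphisms.\<close>

fun input_alphabet :: "trans_desc \<Rightarrow> (nat \<times> nat) list" where
  "input_alphabet (Rel_Desc \<Sigma> \<Delta> tab) = \<Sigma>"
| "input_alphabet (Restr_Desc (FTA_Desc \<Sigma> Q F tab)) = \<Sigma>"
| "input_alphabet (Hom_Desc \<Sigma> \<Delta> tab) = \<Sigma>"

fun succs :: "trans_desc \<Rightarrow> table \<Rightarrow> nat \<Rightarrow> (nat \<times> nat) list \<Rightarrow> (nat \<times> nat) set" where
  "succs (Rel_Desc \<Sigma> \<Delta> tab) T a zs = {(0, tstep T b (map snd zs)) | b. ((length zs, a), b) \<in> set tab}"
| "succs (Restr_Desc (FTA_Desc \<Sigma> Q F tab)) T a zs = {(tstep tab a (map fst zs), tstep T a (map snd zs))}"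
| "succs (Hom_Desc \<Sigma> \<Delta> tab) T a zs =
    {(0, teval T (map snd zs) p) | p. map_of tab (length zs, a) = Some p}"

fun final_value :: "trans_desc \<Rightarrow> nat list \<Rightarrow> nat \<times> nat \<Rightarrow> bool" where
  "final_value (Restr_Desc (FTA_Desc \<Sigma> Q F tab)) F' z \<longleftrightarrow> fst z \<in> set F \<and> snd z \<in> set F'"
| "final_value _ F' z \<longleftrightarrow> snd z \<in> set F'"

text \<open>Only relabelings make the evaluation nondeterministic. Collecting all values in one set
  is the subset construction; it turns the evaluation into a map to which
  \<open>finite_algebra_automaton\<close> applies.\<close>

primrec vals :: "(nat \<Rightarrow> 'z list \<Rightarrow> 'z set) \<Rightarrow> nat tree \<Rightarrow> 'z set" where
  "vals H (Node a ts) = \<Union> (H a ` listset (map (vals H) ts))"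

lemma in_vals_Node_iff:
  "z \<in> vals H (Node a ts) \<longleftrightarrow> (\<exists>zs. list_all2 (\<lambda>z t. z \<in> vals H t) zs ts \<and> z \<in> H a zs)"
  by (auto simp: listset_iff_list_all2 list_all2_map2)

lemma vals_singleton:
  assumes "\<And>a ts. Node a ts \<in> trees \<Sigma> \<Longrightarrow> H a (map v ts) = {v (Node a ts)}" and "t \<in> trees \<Sigma>"
  shows "vals H t = {v t}"
  using assms(2)
proof (induction rule: trees.induct)
  case (1 a ts)
  then have "list_all2 (\<lambda>z t. z \<in> vals H t) zs ts \<longleftrightarrow> zs = map v ts" for zs
    by (auto simp: list_all2_conv_all_nth list_eq_iff_nth_eq)
  then have "z \<in> vals H (Node a ts) \<longleftrightarrow> z \<in> H a (map v ts)" for z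
    unfolding in_vals_Node_iff by simp
  then show ?case using assms(1)[of a ts] 1 by auto
qed

text \<open>Below a valid description never looks up a missing entry, so \<open>the\<close> and the
  default 0 cannot disagree. Membership of the state in \<open>Q\<close> is carried along because
  validity speaks only of such states.\<close>

lemma run_fta_of:
  assumes "valid_fta (FTA_Desc \<Sigma> Q F tab)" and "t \<in> trees (set \<Sigma>)"
  shows "run (fta_of (FTA_Desc \<Sigma> Q F tab)) t \<in> set Q \<and> run (fta_of (FTA_Desc \<Sigma> Q F tab)) t = trun tab t"
  using assms(2)
proof (induction rule: trees.induct)
  case (1 a ts)
  let ?A = "fta_of (FTA_Desc \<Sigma> Q F tab)"
  from 1 have qs: "map (run ?A) ts = map (trun tab) ts" "set (map (trun tab) ts) \<subseteq> set Q"
    by auto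
  with 1 assms(1) have "(a, map (trun tab) ts) \<in> dom (map_of tab)" "step ?A a (map (trun tab) ts) \<in> set Q"
    by (auto simp: is_fta_def)
  with qs show ?case by (auto simp: tstep_def simp del: map_eq_conv)
qed

lemma fta_lang_fta_of:
  assumes "valid_fta (FTA_Desc \<Sigma> Q F tab)"
  shows "fta_lang (fta_of (FTA_Desc \<Sigma> Q F tab)) = {t \<in> trees (set \<Sigma>). trun tab t \<in> set F}"
  using run_fta_of[OF assms] by (auto simp: fta_lang_def)

lemma vals_Rel:
  "vals (succs (Rel_Desc \<Sigma> \<Delta> tab) T) s = {(0, trun T u) | u. u \<in> relabel (rel_of tab) s}"
proof (induction s)
  case (Node a ss)
  show ?case
  proof (intro equalityI subsetI)
    fix z assume "z \<in> vals (succs (Rel_Desc \<Sigma> \<Delta> tab) T) (Node a ss)"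
    then obtain zs b where zs: "list_all2 (\<lambda>z s. z \<in> vals (succs (Rel_Desc \<Sigma> \<Delta> tab) T) s) zs ss"
      and z: "z = (0, tstep T b (map snd zs))" "((length zs, a), b) \<in> set tab"
      unfolding in_vals_Node_iff by auto
    have "list_all2 (\<lambda>z s. \<exists>u. u \<in> relabel (rel_of tab) s \<and> z = (0, trun T u)) zs ss"
      using zs by (rule list.rel_mono_strong) (use Node in auto)
    then have "\<forall>i<length ss. \<exists>u. u \<in> relabel (rel_of tab) (ss ! i) \<and> zs ! i = (0, trun T u)"
      and len: "length zs = length ss"
      by (auto simp: list_all2_conv_all_nth)
    then obtain U where U: "\<And>i. i < length ss \<Longrightarrow> U i \<in> relabel (rel_of tab) (ss ! i) \<and> zs ! i = (0, trun T (U i))"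
      by metis
    let ?us = "map U [0..<length ss]"
    have "Node b ?us \<in> relabel (rel_of tab) (Node a ss)"
      unfolding in_relabel_Node_iff using U z(2) len by (auto simp: list_all2_conv_all_nth rel_of_def)
    moreover have "map snd zs = map (trun T) ?us"
      using U len by (intro nth_equalityI) auto
    then have "z = (0, trun T (Node b ?us))"
      unfolding z(1) trun.simps by (simp only:)
    ultimately show "z \<in> {(0, trun T u) | u. u \<in> relabel (rel_of tab) (Node a ss)}"
      by blast
  next
    fix z :: "nat \<times> nat" assume "z \<in> {(0, trun T u) | u. u \<in> relabel (rel_of tab) (Node a ss)}"
    then obtain b us where z: "z = (0, trun T (Node b us))" "((length ss, a), b) \<in> set tab"
      and us: "list_all2 (\<lambda>s u. u \<in> relabel (rel_of tab) s) ss us"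
      unfolding in_relabel_Node_iff by (auto simp: rel_of_def)
    have "list_all2 (\<lambda>z s. z \<in> vals (succs (Rel_Desc \<Sigma> \<Delta> tab) T) s) (map (\<lambda>u. (0, trun T u)) us) ss"
      using us Node by (auto simp: list_all2_conv_all_nth simp del: succs.simps)
    moreover have "length us = length ss" using us by (simp add: list_all2_lengthD)
    ultimately show "z \<in> vals (succs (Rel_Desc \<Sigma> \<Delta> tab) T) (Node a ss)"
      unfolding in_vals_Node_iff using z
      by (intro exI[of _ "map (\<lambda>u. (0, trun T u)) us"]) (auto simp: comp_def)
  qed
qed

lemma vals_Restr:
  assumes "s \<in> trees (set \<Sigma>)"
  shows "vals (succs (Restr_Desc (FTA_Desc \<Sigma> Q F tab)) T) s = {(trun tab s, trun T s)}"
  using assms by (rule vals_singleton[rotated]) (simp add: comp_def)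

lemma vals_Hom:
  assumes "valid_trans (Hom_Desc \<Sigma> \<Delta> tab)" and "s \<in> trees (set \<Sigma>)"
  shows "vals (succs (Hom_Desc \<Sigma> \<Delta> tab) T) s = {(0, trun T (hom (hom_of tab) s))}"
  using assms(2)
proof (rule vals_singleton[rotated])
  fix a ts assume "Node a ts \<in> trees (set \<Sigma>)"
  with assms(1) obtain p where p: "map_of tab (length ts, a) = Some p" "hom_of tab (length ts) a = p"
    "p \<in> vtrees (set \<Delta>) (length ts)"
    by (fastforce simp: is_hom_def hom_of_def)
  then show "succs (Hom_Desc \<Sigma> \<Delta> tab) T a (map (\<lambda>s. (0, trun T (hom (hom_of tab) s))) ts) =
      {(0, trun T (hom (hom_of tab) (Node a ts)))}"
    using trun_subst[of p "set \<Delta>" "map (hom (hom_of tab)) ts" T] by (simp add: comp_def)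
qed

text \<open>Together with \<open>finite_vals\<close>, this is all that the proofs of
  \<open>preimage_automaton\<close> and \<open>covers_iff\<close> use of the particular kind of
  transformation.\<close>

lemma trans_of_acc_iff:
  assumes "valid_trans m"
  shows "(\<exists>u. (s, u) \<in> trans_of m \<and> acc (T, F) u) \<longleftrightarrow>
    s \<in> trees (set (input_alphabet m)) \<and> (\<exists>z\<in>vals (succs m T) s. final_value m F z)"
proof (cases m)
  case (Rel_Desc \<Sigma> \<Delta> tab)
  then show ?thesis by (auto simp: vals_Rel rel_trans_def acc_def simp del: succs.simps)
next
  case (Restr_Desc d)
  obtain \<Sigma> Q F' tab where d: "d = FTA_Desc \<Sigma> Q F' tab" by (cases d)
  have tr: "trans_of m = Id_on {t \<in> trees (set \<Sigma>). trun tab t \<in> set F'}"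
    using assms unfolding Restr_Desc d by (simp only: trans_of.simps valid_trans.simps fta_lang_fta_of)
  show ?thesis
    unfolding tr unfolding Restr_Desc d
    by (auto simp: acc_def vals_Restr Id_on_iff simp del: succs.simps)
next
  case (Hom_Desc \<Sigma> \<Delta> tab)
  with assms vals_Hom show ?thesis
    by (auto simp: Hom_Desc hom_trans_def acc_def simp del: succs.simps valid_trans.simps)
qed

lemma finite_vals:
  assumes "valid_trans m"
  shows "finite (\<Union>s\<in>trees (set (input_alphabet m)). vals (succs m T) s)"
proof (cases m)
  case (Rel_Desc \<Sigma> \<Delta> tab)
  have "(\<Union>s\<in>trees (set (input_alphabet m)). vals (succs m T) s) \<subseteq> {0} \<times> range (trun T)"
    by (auto simp: Rel_Desc vals_Rel simp del: succs.simps)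
  then show ?thesis by (rule finite_subset) (simp add: finite_range_trun)
next
  case (Restr_Desc d)
  obtain \<Sigma> Q F tab where d: "d = FTA_Desc \<Sigma> Q F tab" by (cases d)
  have "(\<Union>s\<in>trees (set (input_alphabet m)). vals (succs m T) s) \<subseteq> range (trun tab) \<times> range (trun T)"
    by (auto simp: Restr_Desc d vals_Restr simp del: succs.simps)
  then show ?thesis by (rule finite_subset) (simp add: finite_range_trun)
next
  case (Hom_Desc \<Sigma> \<Delta> tab)
  have "(\<Union>s\<in>trees (set (input_alphabet m)). vals (succs m T) s) \<subseteq> {0} \<times> range (trun T)"
    using assms vals_Hom by (auto simp: Hom_Desc simp del: succs.simps valid_trans.simps)
  then show ?thesis by (rule finite_subset) (simp add: finite_range_trun)
qed

text \<open>The sets of values of input trees are subsets of one finite set, so they form a finite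
  algebra. The preimage consists of the input trees whose set contains a final value.\<close>

lemma preimage_automaton:
  assumes "valid_trans m"
  shows "\<exists>A'. \<forall>s. acc A' s \<longleftrightarrow> (\<exists>u. (s, u) \<in> trans_of m \<and> acc A u)"
proof -
  obtain T F where A: "A = (T, F)" by (cases A)
  let ?\<Sigma> = "set (input_alphabet m)" and ?v = "vals (succs m T)"
  have "?v ` trees ?\<Sigma> \<subseteq> Pow (\<Union>s\<in>trees ?\<Sigma>. ?v s)" by blast
  then have "finite (?v ` trees ?\<Sigma>)"
    by (rule finite_subset) (simp add: finite_vals[OF assms])
  then have "\<exists>A'. \<forall>s. acc A' s \<longleftrightarrow> s \<in> trees ?\<Sigma> \<and> (\<exists>z\<in>?v s. final_value m F z)"
    by (rule finite_algebra_automaton[rotated, where P = "\<lambda>X. \<exists>z\<in>X. final_value m F z" and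
          g = "\<lambda>a Xs. \<Union> (succs m T a ` listset Xs)"]) simp_all
  then show ?thesis unfolding A trans_of_acc_iff[OF assms] .
qed

text \<open>The list \<open>R\<close> certifies the inclusion in \<open>covers_iff\<close>. The least such \<open>R\<close> consists of all pairs of a
  state of \<open>A'\<close> and a value reached on a common input tree.\<close>

definition certified :: "trans_desc \<Rightarrow> automaton \<Rightarrow> automaton \<Rightarrow> (nat \<times> nat \<times> nat) list \<Rightarrow> bool" where
  "certified m A' A R \<longleftrightarrow>
    (\<forall>e\<in>set (input_alphabet m). \<forall>zs. length zs = snd e \<and> set zs \<subseteq> set R \<longrightarrow>
      (\<forall>z\<in>succs m (fst A) (fst e) (map snd zs). (tstep (fst A') (fst e) (map fst zs), z) \<in> set R)) \<and>
    (\<forall>z\<in>set R. \<not> final_value m (snd A) (snd z) \<or> fst z \<in> set (snd A'))"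

definition covers :: "trans_desc \<Rightarrow> automaton \<Rightarrow> automaton \<Rightarrow> bool" where
  "covers m A' A \<longleftrightarrow> (\<exists>R. certified m A' A R)"

lemma certified_step:
  assumes "certified m (T', F') (T, F) R" and "set zs \<subseteq> set R"
    and "(a, length zs) \<in> set (input_alphabet m)" and "z \<in> succs m T a (map snd zs)"
  shows "(tstep T' a (map fst zs), z) \<in> set R"
  using assms(1)[unfolded certified_def, THEN conjunct1, THEN bspec, OF assms(3)] assms(2,4) by simp

text \<open>By induction on the input tree, any closed \<open>R\<close> contains all reachable
  pairs, so a guessed \<open>R\<close> may safely be too large. Conversely the reachable pairs
  themselves are finitely many and closed.\<close>

lemma covers_iff:
  assumes "valid_trans m"
  shows "covers m A' A \<longleftrightarrow> (\<forall>(s, u)\<in>trans_of m. acc A u \<longrightarrow> acc A' s)"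
proof -
  obtain T F T' F' where A: "A = (T, F)" "A' = (T', F')" by (cases A; cases A')
  let ?\<Sigma> = "set (input_alphabet m)" and ?v = "vals (succs m T)"
  have acc_iff: "(\<forall>(s, u)\<in>trans_of m. acc A u \<longrightarrow> acc A' s) \<longleftrightarrow>
      (\<forall>s\<in>trees ?\<Sigma>. \<forall>z\<in>?v s. final_value m F z \<longrightarrow> acc A' s)"
    using trans_of_acc_iff[OF assms, of _ T F] unfolding A by blast
  show ?thesis
    unfolding acc_iff
  proof (intro iffI ballI impI)
    fix s z assume "covers m A' A" and s: "s \<in> trees ?\<Sigma>" and z: "z \<in> ?v s" "final_value m F z"
    then obtain R where R: "certified m A' A R" unfolding covers_def by blast
    have "\<forall>z\<in>?v s. (trun T' s, z) \<in> set R"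
      using s
    proof (induction rule: trees.induct)
      case (1 a ts)
      show ?case
      proof
        fix z assume "z \<in> ?v (Node a ts)"
        then obtain zs where zs: "list_all2 (\<lambda>z t. z \<in> ?v t) zs ts" "z \<in> succs m T a zs"
          unfolding in_vals_Node_iff by blast
        let ?ws = "zip (map (trun T') ts) zs"
        have len: "length zs = length ts" using zs(1) by (rule list_all2_lengthD)
        have "set ?ws \<subseteq> set R"
          using zs(1) 1 by (auto simp: set_zip list_all2_conv_all_nth)
        with R have "(tstep T' a (map fst ?ws), z) \<in> set R"
          unfolding A by (rule certified_step) (use 1 zs(2) len in auto)
        then show "(trun T' (Node a ts), z) \<in> set R"
          using len by simp
      qed
    qed
    with z R show "acc A' s" unfolding certified_def A acc_def by fastforce
  next
    assume incl: "\<forall>s\<in>trees ?\<Sigma>. \<forall>z\<in>?v s. final_value m F z \<longrightarrow> acc A' s"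
    let ?R = "{(trun T' s, z) | s z. s \<in> trees ?\<Sigma> \<and> z \<in> ?v s}"
    have "?R \<subseteq> range (trun T') \<times> (\<Union>s\<in>trees ?\<Sigma>. ?v s)" by blast
    then have "finite ?R"
      by (rule finite_subset) (intro finite_cartesian_product finite_range_trun finite_vals assms)
    then obtain R where R: "set R = ?R" by (meson finite_list)
    have "(tstep T' a (map fst zs), z) \<in> set R"
      if "(a, length zs) \<in> ?\<Sigma>" "set zs \<subseteq> set R" "z \<in> succs m T a (map snd zs)" for a zs z
    proof -
      \<comment> \<open>Both components of a pair come from one tree; these trees become the
        children of a tree on which the new pair is reached.\<close>
      have "\<forall>w\<in>set zs. \<exists>t. t \<in> trees ?\<Sigma> \<and> fst w = trun T' t \<and> snd w \<in> ?v t"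
        using that(2) R by fastforce
      then obtain t where t: "\<And>w. w \<in> set zs \<Longrightarrow> t w \<in> trees ?\<Sigma> \<and> fst w = trun T' (t w) \<and> snd w \<in> ?v (t w)"
        by metis
      have "Node a (map t zs) \<in> trees ?\<Sigma>" using t that(1) by auto
      moreover have "z \<in> ?v (Node a (map t zs))"
        unfolding in_vals_Node_iff using t that(3)
        by (intro exI[of _ "map snd zs"]) (auto simp: list_all2_conv_all_nth)
      moreover have "tstep T' a (map fst zs) = trun T' (Node a (map t zs))"
        using t by (auto intro!: arg_cong[where f = "tstep T' a"])
      ultimately show ?thesis unfolding R by blast
    qed
    moreover have "\<forall>z\<in>set R. \<not> final_value m F (snd z) \<or> fst z \<in> set F'"
      using incl unfolding R by (auto simp: A acc_def)
    ultimately have "certified m A' A R"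
      unfolding certified_def A by auto
    then show "covers m A' A" unfolding covers_def ..
  qed
qed

section \<open>Semidecidability of the chains\<close>

lemma semidec_notin_set [rec_intros]:
  assumes "recursive f" "recursive g"
  shows "semidec (\<lambda>x. f x \<notin> set (g x))"
proof -
  have "f x \<notin> set (g x) \<longleftrightarrow> (\<forall>z\<in>set (g x). f x \<noteq> z)" for x by blast
  then show ?thesis
    by (simp only:) (intro rec_intros assms assms[THEN recursive_compose])
qed

text \<open>The list may contain more than the required tuples, so it can be checked by recursion on
  the length: a list \<open>X\<close> covering the shorter tuples is guessed, and all its extensions
  must be present.\<close>

lemma semidec_all_tuples_in [rec_intros]:
  fixes g :: "'a :: coded \<Rightarrow> 'b :: coded list"
  assumes "recursive f" "recursive g" "recursive h"
  shows "semidec (\<lambda>x. \<forall>zs. length zs = f x \<and> set zs \<subseteq> set (g x) \<longrightarrow> zs \<in> set (h x))"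
proof (rule semidec_compose3[OF _ assms])
  show "semidec (\<lambda>p :: nat \<times> 'b list \<times> 'b list list.
      \<forall>zs. length zs = fst p \<and> set zs \<subseteq> set (fst (snd p)) \<longrightarrow> zs \<in> set (snd (snd p)))"
    (is "semidec ?P")
  proof (rule semidec_induct[where m = "\<lambda>p. fst p" and
        \<Phi> = "\<lambda>l p. fst p = 0 \<and> [] \<in> set (snd (snd p)) \<or>
          (\<exists>k X. fst p = Suc k \<and> (k, fst (snd p), X) \<in> set l \<and>
            (\<forall>z\<in>set (fst (snd p)). \<forall>zs\<in>set X. z # zs \<in> set (snd (snd p))))"])
    fix p :: "nat \<times> 'b list \<times> 'b list list"
    assume P: "?P p"
    obtain k R X where p: "p = (k, R, X)" by (metis surj_pair)
    show "\<exists>l. (\<forall>y\<in>set l. ?P y \<and> fst y < fst p) \<and> (fst p = 0 \<and> [] \<in> set (snd (snd p)) \<or>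
          (\<exists>k X. fst p = Suc k \<and> (k, fst (snd p), X) \<in> set l \<and>
            (\<forall>z\<in>set (fst (snd p)). \<forall>zs\<in>set X. z # zs \<in> set (snd (snd p)))))"
    proof (cases k)
      case 0
      with P p show ?thesis by (intro exI[of _ "[]"]) auto
    next
      case (Suc j)
      with P p show ?thesis
        by (intro exI[of _ "[(j, R, List.n_lists j R)]"]) (auto simp: set_n_lists)
    qed
  next
    fix l and p :: "nat \<times> 'b list \<times> 'b list list"
    assume l: "\<forall>y\<in>set l. ?P y" and "fst p = 0 \<and> [] \<in> set (snd (snd p)) \<or>
          (\<exists>k X. fst p = Suc k \<and> (k, fst (snd p), X) \<in> set l \<and>
            (\<forall>z\<in>set (fst (snd p)). \<forall>zs\<in>set X. z # zs \<in> set (snd (snd p))))"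
    from this(2) show "?P p"
    proof (elim disjE exE conjE)
      fix k X
      assume *: "fst p = Suc k" "(k, fst (snd p), X) \<in> set l"
        "\<forall>z\<in>set (fst (snd p)). \<forall>zs\<in>set X. z # zs \<in> set (snd (snd p))"
      show "?P p"
      proof (intro allI impI)
        fix zs assume zs: "length zs = fst p \<and> set zs \<subseteq> set (fst (snd p))"
        then obtain z zs' where "zs = z # zs'" using *(1) by (cases zs) auto
        with zs * l show "zs \<in> set (snd (snd p))" by fastforce
      qed
    qed auto
  qed (intro rec_intros)
qed

text \<open>A guessed list containing all the tuples makes the quantifier a bounded one. It serves
  the argument tuples of the transitions in \<open>certified\<close>.\<close>

lemma semidec_all_tuples [rec_intros]:
  assumes P: "semidec (\<lambda>p. P (fst p) (snd p))" and "recursive f" "recursive g"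
  shows "semidec (\<lambda>x. \<forall>zs. length zs = f x \<and> set zs \<subseteq> set (g x) \<longrightarrow> P x zs)"
proof -
  have "(\<forall>zs. length zs = f x \<and> set zs \<subseteq> set (g x) \<longrightarrow> P x zs) \<longleftrightarrow>
      (\<exists>X. (\<forall>zs. length zs = f x \<and> set zs \<subseteq> set (g x) \<longrightarrow> zs \<in> set X) \<and> (\<forall>zs\<in>set X. P x zs))" for x
  proof
    assume "\<forall>zs. length zs = f x \<and> set zs \<subseteq> set (g x) \<longrightarrow> P x zs"
    then show "\<exists>X. (\<forall>zs. length zs = f x \<and> set zs \<subseteq> set (g x) \<longrightarrow> zs \<in> set X) \<and> (\<forall>zs\<in>set X. P x zs)"
      by (intro exI[of _ "List.n_lists (f x) (g x)"]) (auto simp: set_n_lists)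
  qed blast
  then show ?thesis
    by (simp only:) (intro rec_intros assms assms(2-)[THEN recursive_compose] P[THEN semidec_compose2])
qed

text \<open>Used with trees to witness membership and with automata to witness rejection; in both
  cases the list holds the codes of the transformations.\<close>

primrec chain :: "('n \<Rightarrow> 'x \<Rightarrow> 'x \<Rightarrow> bool) \<Rightarrow> 'n list \<Rightarrow> 'x \<Rightarrow> 'x \<Rightarrow> bool" where
  "chain R [] x y \<longleftrightarrow> x = y"
| "chain R (n # ns) x y \<longleftrightarrow> (\<exists>z. R n x z \<and> chain R ns z y)"

lemma semidec_chain:
  fixes f :: "'a :: coded \<Rightarrow> 'n :: coded list" and g :: "'a \<Rightarrow> 'x :: coded"
  assumes R: "semidec (\<lambda>p. R (fst p) (fst (snd p)) (snd (snd p)))"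
    and "recursive f" "recursive g" "recursive h"
  shows "semidec (\<lambda>x. chain R (f x) (g x) (h x))"
proof (rule semidec_compose3[OF _ assms(2-)])
  show "semidec (\<lambda>p :: 'n list \<times> 'x \<times> 'x. chain R (fst p) (fst (snd p)) (snd (snd p)))" (is "semidec ?P")
  proof (rule semidec_induct[where m = "\<lambda>p. length (fst p)" and
        \<Phi> = "\<lambda>l p. fst p = [] \<and> fst (snd p) = snd (snd p) \<or>
          (\<exists>n ns z. fst p = n # ns \<and> R n (fst (snd p)) z \<and> (ns, z, snd (snd p)) \<in> set l)"])
    fix p :: "'n list \<times> 'x \<times> 'x"
    assume P: "?P p"
    obtain ns x y where p: "p = (ns, x, y)" by (metis surj_pair)
    show "\<exists>l. (\<forall>y\<in>set l. ?P y \<and> length (fst y) < length (fst p)) \<and>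
        (fst p = [] \<and> fst (snd p) = snd (snd p) \<or>
          (\<exists>n ns z. fst p = n # ns \<and> R n (fst (snd p)) z \<and> (ns, z, snd (snd p)) \<in> set l))"
    proof (cases ns)
      case Nil
      with P p show ?thesis by (intro exI[of _ "[]"]) auto
    next
      case (Cons n ns')
      with P p obtain z where "R n x z" "chain R ns' z y" by auto
      with Cons p show ?thesis by (intro exI[of _ "[(ns', z, y)]"]) auto
    qed
  qed (intro rec_intros R[THEN semidec_compose3], fastforce)
qed

section \<open>Codes of descriptions as codes of lists\<close>

lemma id_eq_enc: "id = (enc :: nat \<Rightarrow> nat)"
  by (simp add: fun_eq_iff)

lemma code_pair_eq_enc: "code_pair enc enc = enc"
  by (simp add: fun_eq_iff code_pair_def enc_prod_def)

lemma code_list_eq_enc: "code_list enc = enc"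
  by (simp add: fun_eq_iff code_list_def enc_list_def)

lemma code_tree_eq_enc: "code_tree = enc"
proof
  show "code_tree t = enc t" for t
    by (induction t) (auto intro!: arg_cong[where f = list_encode])
qed

lemma code_vtree_eq_enc: "code_vtree = enc"
proof
  show "code_vtree p = enc p" for p
    by (induction p) (auto intro!: arg_cong[where f = list_encode] arg_cong[where f = sum_encode])
qed

lemma list_encode_eq_enc: "list_encode = enc"
  by (simp add: fun_eq_iff enc_list_def flip: id_eq_enc)

lemmas code_eq_enc = id_eq_enc code_pair_eq_enc code_list_eq_enc code_tree_eq_enc code_vtree_eq_enc
  list_encode_eq_enc

lemma code_fta_eq_enc: "code_fta (FTA_Desc \<Sigma> Q F tab) = enc [enc \<Sigma>, enc Q, enc F, enc tab]"
  by (simp only: code_fta.simps code_eq_enc)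

lemma code_trans_eq_enc:
  "code_trans (Rel_Desc \<Sigma> \<Delta> rtab) = enc [0, enc \<Sigma>, enc \<Delta>, enc rtab]"
  "code_trans (Restr_Desc d) = enc [1, code_fta d]"
  "code_trans (Hom_Desc \<Sigma> \<Delta> htab) = enc [2, enc \<Sigma>, enc \<Delta>, enc htab]"
  by (simp_all only: code_trans.simps code_eq_enc)

text \<open>Not every number is the code of a description, so descriptions are no instance of
  \<open>coded\<close>. Splitting the quantifier leaves only variables of coded types.\<close>

lemma ex_trans_desc_iff:
  "(\<exists>m. P m) \<longleftrightarrow> (\<exists>\<Sigma> \<Delta> tab. P (Rel_Desc \<Sigma> \<Delta> tab)) \<or>
    (\<exists>\<Sigma> Q F tab. P (Restr_Desc (FTA_Desc \<Sigma> Q F tab))) \<or> (\<exists>\<Sigma> \<Delta> tab. P (Hom_Desc \<Sigma> \<Delta> tab))"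
  by (metis fta_desc.exhaust trans_desc.exhaust)

text \<open>A variant of \<open>trans_of\<close> without unspecified values, hence semidecidable for
  arbitrary descriptions; on valid ones the two agree.\<close>

fun applies :: "trans_desc \<Rightarrow> nat tree \<Rightarrow> nat tree \<Rightarrow> bool" where
  "applies (Rel_Desc \<Sigma> \<Delta> tab) s u \<longleftrightarrow> s \<in> trees (set \<Sigma>) \<and> u \<in> relabel (rel_of tab) s"
| "applies (Restr_Desc (FTA_Desc \<Sigma> Q F tab)) s u \<longleftrightarrow> s \<in> trees (set \<Sigma>) \<and> trun tab s \<in> set F \<and> s = u"
| "applies (Hom_Desc \<Sigma> \<Delta> tab) s u \<longleftrightarrow>
    s \<in> trees (set \<Sigma>) \<and> s \<in> trees (hom_dom tab) \<and> hom (hom_of tab) s = u"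

lemma applies_iff:
  assumes "valid_trans m"
  shows "applies m s u \<longleftrightarrow> (s, u) \<in> trans_of m"
proof (cases m)
  case (Rel_Desc \<Sigma> \<Delta> tab)
  then show ?thesis by (simp add: rel_trans_def)
next
  case (Restr_Desc d)
  obtain \<Sigma> Q F tab where d: "d = FTA_Desc \<Sigma> Q F tab" by (cases d)
  have "trans_of m = Id_on {t \<in> trees (set \<Sigma>). trun tab t \<in> set F}"
    using assms unfolding Restr_Desc d by (simp only: trans_of.simps valid_trans.simps fta_lang_fta_of)
  then show ?thesis
    unfolding Restr_Desc d by (auto simp del: trans_of.simps)
next
  case (Hom_Desc \<Sigma> \<Delta> tab)
  with assms have "set \<Sigma> \<subseteq> hom_dom tab"
    by (fastforce simp: hom_dom_def is_hom_def hom_of_def intro: vtrees_mono)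
  then show ?thesis
    using trees_mono[of s "set \<Sigma>" "hom_dom tab"] by (auto simp: Hom_Desc hom_trans_def)
qed

definition trans_step :: "nat \<Rightarrow> nat tree \<Rightarrow> nat tree \<Rightarrow> bool" where
  "trans_step n s u \<longleftrightarrow> (\<exists>m. n = code_trans m \<and> applies m s u)"

definition cover_step :: "nat \<Rightarrow> automaton \<Rightarrow> automaton \<Rightarrow> bool" where
  "cover_step n A' A \<longleftrightarrow> (\<exists>m. n = code_trans m \<and> covers m A' A)"

lemma semidec_trans_step: "semidec (\<lambda>p. trans_step (fst p) (fst (snd p)) (snd (snd p)))"
  unfolding trans_step_def ex_trans_desc_iff applies.simps code_trans_eq_enc code_fta_eq_enc
  by (intro rec_intros)

text \<open>This and the next two equations bring the quantifier over values into a form built from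
  semidecidable connectives, with implications as disjunctions of an inequality and the conclusion
  or of a lookup and its failure.\<close>

lemma Ball_succs_Rel:
  "(\<forall>z\<in>succs (Rel_Desc \<Sigma> \<Delta> tab) T a zs. P z) \<longleftrightarrow>
    (\<forall>e\<in>set tab. fst e \<noteq> (length zs, a) \<or> P (0, tstep T (snd e) (map snd zs)))"
  by fastforce

lemma Ball_succs_Restr:
  "(\<forall>z\<in>succs (Restr_Desc (FTA_Desc \<Sigma> Q F tab)) T a zs. P z) \<longleftrightarrow>
    P (tstep tab a (map fst zs), tstep T a (map snd zs))"
  by simp

lemma Ball_succs_Hom:
  "(\<forall>z\<in>succs (Hom_Desc \<Sigma> \<Delta> tab) T a zs. P z) \<longleftrightarrow>
    (\<exists>p. map_of tab (length zs, a) = Some p \<and> P (0, teval T (map snd zs) p)) \<or>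
    (\<forall>e\<in>set tab. fst e \<noteq> (length zs, a))"
  by (auto simp flip: map_of_eq_None_iff_Ball)

lemma semidec_cover_step: "semidec (\<lambda>p. cover_step (fst p) (fst (snd p)) (snd (snd p)))"
  unfolding cover_step_def ex_trans_desc_iff covers_def certified_def Ball_succs_Rel Ball_succs_Restr
    Ball_succs_Hom input_alphabet.simps final_value.simps de_Morgan_conj code_trans_eq_enc code_fta_eq_enc
  by (intro rec_intros)

lemma trans_step_iff:
  "valid_trans m \<Longrightarrow> trans_step (code_trans m) s u \<longleftrightarrow> (s, u) \<in> trans_of m"
  using inj_code_trans by (auto simp: trans_step_def inj_eq applies_iff)

lemma cover_step_iff:
  "valid_trans m \<Longrightarrow> cover_step (code_trans m) A' A \<longleftrightarrow> (\<forall>(s, u)\<in>trans_of m. acc A u \<longrightarrow> acc A' s)"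
  using inj_code_trans by (auto simp: cover_step_def inj_eq covers_iff)

section \<open>Correctness of the chains\<close>

lemma compose_Nil [simp]: "compose [] = Id"
  by (simp add: compose_def)

lemma compose_Cons [simp]: "compose (M # Ms) = M O compose Ms"
  by (simp add: compose_def)

lemma chain_trans_step_iff:
  assumes "\<forall>m\<in>set ms. valid_trans m"
  shows "chain trans_step (map code_trans ms) s t \<longleftrightarrow> (s, t) \<in> compose (map trans_of ms)"
  using assms by (induction ms arbitrary: s) (auto simp: trans_step_iff simp del: trans_of.simps)

lemma chain_cover_step_sound:
  assumes "\<forall>m\<in>set ms. valid_trans m" and "chain cover_step (map code_trans ms) A' A"
    and "(s, t) \<in> compose (map trans_of ms)" and "acc A t"
  shows "acc A' s"
  using assms
proof (induction ms arbitrary: A' s)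
  case (Cons m ms)
  then obtain B u where "cover_step (code_trans m) A' B" "chain cover_step (map code_trans ms) B A"
    "(s, u) \<in> trans_of m" "(u, t) \<in> compose (map trans_of ms)" by auto
  with Cons show ?case using cover_step_iff[of m A' B] by fastforce
qed simp

text \<open>The chain is built from the last transformation backwards. Each step takes the exact
  preimage, the least language that covers it.\<close>

lemma chain_cover_step_complete:
  assumes "\<forall>m\<in>set ms. valid_trans m"
  shows "\<exists>A'. chain cover_step (map code_trans ms) A' A \<and>
    (\<forall>s. acc A' s \<longleftrightarrow> (\<exists>t. (s, t) \<in> compose (map trans_of ms) \<and> acc A t))"
  using assms
proof (induction ms)
  case (Cons m ms)
  then obtain B where B: "chain cover_step (map code_trans ms) B A"
    "\<And>s. acc B s \<longleftrightarrow> (\<exists>t. (s, t) \<in> compose (map trans_of ms) \<and> acc A t)" by auto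
  have m: "valid_trans m" using Cons.prems by simp
  obtain A' where A': "\<And>s. acc A' s \<longleftrightarrow> (\<exists>u. (s, u) \<in> trans_of m \<and> acc B u)"
    using preimage_automaton[OF m] by blast
  then have "cover_step (code_trans m) A' B" unfolding cover_step_iff[OF m] by blast
  with B have "chain cover_step (map code_trans (m # ms)) A' A"
    unfolding list.map chain.simps by blast
  moreover have "acc A' s \<longleftrightarrow> (\<exists>t. (s, t) \<in> compose (map trans_of (m # ms)) \<and> acc A t)" for s
    unfolding A' B(2) by auto
  ultimately show ?case by blast
qed simp

text \<open>The automaton of the base language becomes a restriction in front of the chain, so that
  the language is the range of a single composition.\<close>

lemma in_surface_lang_iff:
  assumes "valid_surface (d, ms)"
  shows "t \<in> surface_lang (d, ms) \<longleftrightarrow>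
    (\<exists>s. chain trans_step (map code_trans (Restr_Desc d # ms)) s t)"
proof -
  have "\<forall>m\<in>set (Restr_Desc d # ms). valid_trans m"
    using assms by (auto simp: valid_surface_def)
  from chain_trans_step_iff[OF this] show ?thesis
    by (auto simp: surface_lang_def Image_def)
qed

lemma surface_lang_rejected_iff:
  assumes "valid_surface (d, ms)"
  shows "(\<exists>T. chain cover_step (map code_trans (Restr_Desc d # ms)) (T, []) A) \<longleftrightarrow>
    (\<forall>t\<in>surface_lang (d, ms). \<not> acc A t)"
proof -
  have valid: "\<forall>m\<in>set (Restr_Desc d # ms). valid_trans m"
    using assms by (auto simp: valid_surface_def)
  show ?thesis
  proof
    assume "\<exists>T. chain cover_step (map code_trans (Restr_Desc d # ms)) (T, []) A"
    then obtain T where T: "chain cover_step (map code_trans (Restr_Desc d # ms)) (T, []) A" ..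
    show "\<forall>t\<in>surface_lang (d, ms). \<not> acc A t"
    proof (intro ballI notI)
      fix t assume "t \<in> surface_lang (d, ms)" and t: "acc A t"
      then obtain s where "(s, t) \<in> compose (map trans_of (Restr_Desc d # ms))"
        by (auto simp: surface_lang_def)
      from chain_cover_step_sound[OF valid T this t] show False by (simp add: acc_def)
    qed
  next
    assume rej: "\<forall>t\<in>surface_lang (d, ms). \<not> acc A t"
    obtain B where B: "chain cover_step (map code_trans ms) B A"
      "\<And>s. acc B s \<longleftrightarrow> (\<exists>t. (s, t) \<in> compose (map trans_of ms) \<and> acc A t)"
      using chain_cover_step_complete[of ms A] valid by auto
    have "valid_trans (Restr_Desc d)" using valid by simp
    \<comment> \<open>The premise \<open>acc B u\<close> never holds here, since \<open>u\<close>
      lies in the base language and would be sent to a member accepted by \<open>A\<close>. So an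
      automaton without final states covers.\<close>
    moreover have "\<forall>(s, u)\<in>trans_of (Restr_Desc d). acc B u \<longrightarrow> acc ([], []) s"
      using rej by (auto simp: B(2) surface_lang_def)
    ultimately have "cover_step (code_trans (Restr_Desc d)) ([], []) B"
      using cover_step_iff by blast
    with B(1) have "chain cover_step (map code_trans (Restr_Desc d # ms)) ([], []) A"
      unfolding list.map chain.simps by blast
    then show "\<exists>T. chain cover_step (map code_trans (Restr_Desc d # ms)) (T, []) A" ..
  qed
qed

lemma surface_lang_empty_iff:
  assumes "valid_surface (d, ms)"
  shows "surface_lang (d, ms) = {} \<longleftrightarrow>
    (\<exists>T. chain cover_step (map code_trans (Restr_Desc d # ms)) (T, []) ([], [0]))"
proof -
  \<comment> \<open>The empty table sends every tree to the default state 0, which is final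
    here.\<close>
  have "acc ([], [0]) t" for t by (cases t) (simp add: acc_def tstep_def)
  with surface_lang_rejected_iff[OF assms, of "([], [0])"] show ?thesis by auto
qed

lemma not_in_surface_lang_iff:
  assumes "valid_surface (d, ms)"
  shows "t \<notin> surface_lang (d, ms) \<longleftrightarrow>
    (\<exists>A T. trun (fst A) t \<in> set (snd A) \<and> chain cover_step (map code_trans (Restr_Desc d # ms)) (T, []) A)"
proof -
  \<comment> \<open>If \<open>A\<close> accepts \<open>t\<close> alone, rejecting the language means
    not containing \<open>t\<close>; conversely any rejecting automaton that accepts
    \<open>t\<close> excludes it.\<close>
  obtain A where "\<And>s. acc A s \<longleftrightarrow> s = t" using singleton_automaton by blast
  then have "t \<notin> surface_lang (d, ms) \<longleftrightarrow> (\<exists>A. acc A t \<and> (\<forall>t\<in>surface_lang (d, ms). \<not> acc A t))"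
    by metis
  then show ?thesis
    by (simp only: acc_def surface_lang_rejected_iff[OF assms, symmetric, unfolded acc_def] ex_simps)
qed

lemma code_surface_eq_enc: "code_surface (d, ms) = enc (code_fta d, map code_trans ms)"
  by (simp add: code_surface_def code_pair_def code_list_def enc_prod_def enc_list_def comp_def)

theorem theorem4p88:
  shows "solvable {D. valid_surface D} (\<lambda>D. [code_surface D]) (\<lambda>D. surface_lang D = {}) \<and>
    solvable ({D. valid_surface D} \<times> UNIV) (\<lambda>(D, t). [code_surface D, code_tree t])
      (\<lambda>(D, t). t \<in> surface_lang D)"
proof
  \<comment> \<open>The head is the code of the restriction to the base language, formed from the
    code of its automaton alone; the term makes sense for arbitrary numbers.\<close>
  let ?codes = "\<lambda>x :: nat \<times> nat list. enc [1, fst x] # snd x"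
  have codes: "?codes (code_fta d, map code_trans ms) = map code_trans (Restr_Desc d # ms)" for d ms
    by (simp only: fst_conv snd_conv list.map code_trans_eq_enc)
  note chains = semidec_chain[OF semidec_trans_step] semidec_chain[OF semidec_cover_step]
  let ?Empty = "\<lambda>x. \<exists>T. chain cover_step (?codes x) (T, []) ([], [0])"
  let ?Nonempty = "\<lambda>x. \<exists>s t. chain trans_step (?codes x) s t"
  have "semidec ?Empty" "semidec ?Nonempty"
    by (intro rec_intros chains)+
  from solvable_complementary[OF this] obtain f where
    f: "\<And>x. (?Empty x \<longleftrightarrow> \<not> ?Nonempty x) \<Longrightarrow> evaluates f [enc x] (if ?Empty x then 1 else 0)" by blast
  have "evaluates f [code_surface D] (if surface_lang D = {} then 1 else 0)" if "valid_surface D" for D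
  proof -
    obtain d ms where D: "D = (d, ms)" by (cases D)
    with that have valid: "valid_surface (d, ms)" by simp
    let ?x = "(code_fta d, map code_trans ms)"
    have "?Empty ?x \<longleftrightarrow> surface_lang D = {}"
      unfolding codes D surface_lang_empty_iff[OF valid] ..
    moreover have "?Nonempty ?x \<longleftrightarrow> surface_lang D \<noteq> {}"
      unfolding codes D using in_surface_lang_iff[OF valid] by blast
    ultimately show ?thesis
      using f[of ?x] unfolding D code_surface_eq_enc by presburger
  qed
  then show "solvable {D. valid_surface D} (\<lambda>D. [code_surface D]) (\<lambda>D. surface_lang D = {})"
    unfolding solvable_def by blast
  let ?In = "\<lambda>y. \<exists>s. chain trans_step (?codes (fst y)) s (snd y)"
  let ?Out = "\<lambda>y. \<exists>A T. trun (fst A) (snd y) \<in> set (snd A) \<and> chain cover_step (?codes (fst y)) (T, []) A"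
  have "semidec ?In" "semidec ?Out"
    by (intro rec_intros chains)+
  from solvable_complementary[OF this] obtain g where
    g: "\<And>y. (?In y \<longleftrightarrow> \<not> ?Out y) \<Longrightarrow> evaluates g [enc y] (if ?In y then 1 else 0)" by blast
  \<comment> \<open>A membership instance is presented as two numbers, whereas \<open>g\<close>
    expects the code of a pair; \<open>p\<close> does the pairing.\<close>
  have "computable (Suc (Suc 0)) (\<lambda>xs. prod_encode (xs ! 0, xs ! 1))"
    by (intro computable_prod_encode computable_proj) simp_all
  then obtain p where p: "\<And>xs. length xs = Suc (Suc 0) \<Longrightarrow> evaluates p xs (prod_encode (xs ! 0, xs ! 1))"
    unfolding computable_def by blast
  have "evaluates (Comp g [p]) [code_surface D, code_tree t] (if t \<in> surface_lang D then 1 else 0)"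
    if "valid_surface D" for D t
  proof -
    obtain d ms where D: "D = (d, ms)" by (cases D)
    with that have valid: "valid_surface (d, ms)" by simp
    let ?y = "((code_fta d, map code_trans ms), t)"
    have "?In ?y \<longleftrightarrow> t \<in> surface_lang D"
      unfolding fst_conv[of _ t] snd_conv[of _ t] codes D in_surface_lang_iff[OF valid] ..
    moreover have "?Out ?y \<longleftrightarrow> t \<notin> surface_lang D"
      unfolding fst_conv[of _ t] snd_conv[of _ t] codes D not_in_surface_lang_iff[OF valid] ..
    ultimately have "evaluates g [enc ?y] (if t \<in> surface_lang D then 1 else 0)"
      using g[of ?y] by presburger
    moreover have "enc ?y = prod_encode (code_surface D, code_tree t)"
      by (simp add: D code_surface_eq_enc code_tree_eq_enc enc_prod_def)
    ultimately show ?thesis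
      using p[of "[code_surface D, code_tree t]"]
      by (intro evaluates.intros(4)[where ys = "[enc ?y]"]) auto
  qed
  then show "solvable ({D. valid_surface D} \<times> UNIV) (\<lambda>(D, t). [code_surface D, code_tree t])
      (\<lambda>(D, t). t \<in> surface_lang D)"
    unfolding solvable_def by (intro exI[of _ "Comp g [p]"]) auto
qed

end
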